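(* Let $\mathcal{E}$ be the planar $3$-colorable subgroup of Thompson's group $F$ and $\mathcal{E}_{\rm EVEN}=\mathcal{E}\cap K_{(2,2)}$. Then: (1) ${\rm Comm}_{F}(\mathcal{E}_{\rm EVEN})=\mathcal{E}$; (2) ${\rm Comm}_{K_{(2,2)}}(\mathcal{E}_{\rm EVEN})={\rm Comm}_{K_{(2,1)}}(\mathcal{E}_{\rm EVEN})=\mathcal{E}_{\rm EVEN}$.
   Context: For a group $G$ and a subgroup $H$, the commensurator is ${\rm Comm}_G(H)=\{g\in G: H\cap gHg^{-1}\text{ has finite index in both } H \text{ and } gHg^{-1}\}$. Thompson's group $F$ is the group of piecewise linear homeomorphisms of $[0,1]$ differentiable except at finitely many dyadic rationals, with all slopes powers of $2$; the product is $(f\cdot g)(t)=g(f(t))$. For positive integers $a,b$, $K_{(a,b)}=\{f\in F: \log_2 f'(0)\in a\mathbb{Z},\ \log_2 f'(1)\in b\mathbb{Z}\}$. Tree diagrams: a tree diagram is a pair $(T_+,T_-)$ of finite planar rooted binary trees with the same number $n$ of leaves. Vertices are finite binary words (root = empty word, $v0$ and $v1$ = left and right child of $v$). It represents the element of $F$ sending $.\alpha_k\gamma$ to $.\beta_k\gamma$ for each $k$ and each infinite binary word $\gamma$, where $\alpha_k,\beta_k$ are the $k$-th leaves (from left to right) of $T_+,T_-$. Every element of $F$ is so represented, uniquely up to inserting/deleting pairs of opposing carets. One draws $T_-$ upside down below $T_+$ and identifies the $k$-th leaves of the two trees. Planar $3$-colorable subgroup $\mathcal{E}$: ignoring edges sprouting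 upward/downward from the two roots, the diagram partitions the plane into regions: the outer region $R_0=R_n$ and, for $1\le i\le n-1$, the region $R_i$ between the $i$-th and $(i+1)$-th leaves. If $v$ is a non-root vertex of $T_+$ or $T_-$ whose descendant leaves are numbers $p+1,\dots,q$, the edge from $v$ to its parent separates $R_p$ from $R_q$. $\mathcal{E}$ is the subgroup of elements whose plane partition is $3$-colorable: there is a map $c$ from the regions to $\mathbb{Z}_3$ giving different colors to regions sharing an edge, i.e. $c(R_p)\neq c(R_q)$ for each such $v$. This does not depend on the tree diagram chosen. *)

theory Defs
  imports
    "HOL-Analysis.Analysis"
    "HOL-Algebra.Coset"
    "HOL-Library.Stream"
    "HOL-Library.Sublist"
begin

section \<open>Commensurators\<close>

definition has_finite_index :: "('a, 'b) monoid_scheme \<Rightarrow> 'a set \<Rightarrow> 'a set \<Rightarrow> bool" where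
  "has_finite_index G L H \<longleftrightarrow> finite (rcosets\<^bsub>G\<lparr>carrier := H\<rparr>\<^esub> L)"

definition conjugate_set :: "('a, 'b) monoid_scheme \<Rightarrow> 'a \<Rightarrow> 'a set \<Rightarrow> 'a set" where
  "conjugate_set G g H = (g <#\<^bsub>G\<^esub> H) #>\<^bsub>G\<^esub> (inv\<^bsub>G\<^esub> g)"

definition commensurator :: "('a, 'b) monoid_scheme \<Rightarrow> 'a set \<Rightarrow> 'a set" where
  "commensurator G H =
    {g \<in> carrier G.
       has_finite_index G (H \<inter> conjugate_set G g H) H \<and>
       has_finite_index G (H \<inter> conjugate_set G g H) (conjugate_set G g H)}"


section \<open>Thompson's group F\<close>

definition dyadic_rationals :: "real set" where
  "dyadic_rationals = {of_int m / 2 ^ n | (m :: int) (n :: nat). True}"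

definition piecewise_linear :: "(real \<Rightarrow> real) \<Rightarrow> bool" where
  "piecewise_linear f \<longleftrightarrow>
    (\<exists>B. finite B \<and>
      (\<forall>a b. 0 \<le> a \<and> a < b \<and> b \<le> 1 \<and> {a<..<b} \<inter> B = {} \<longrightarrow>
        (\<exists>m c. \<forall>x\<in>{a<..<b}. f x = m * x + c)))"

text \<open>Homeomorphisms of the unit interval are represented by functions that are
  \<^const>\<open>undefined\<close> outside it, so that equal maps are equal as functions.  The derivatives
  at 0 and 1 are one-sided.  The product applies the left factor first.\<close>

definition thompson_F :: "(real \<Rightarrow> real) monoid" where
  "thompson_F =
    \<lparr>carrier = {f \<in> extensional {0..1}.
        (\<exists>g. homeomorphism {0..1} {0..1} f g) \<and>
        piecewise_linear f \<and>
        (\<exists>S. finite S \<and> S \<subseteq> dyadic_rationals \<and>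
          (\<forall>x\<in>{0..1} - S. \<exists>k::int.
            (f has_real_derivative 2 powi k) (at x within {0..1})))},
     mult = (\<lambda>f g. compose {0..1} g f),
     one = (\<lambda>x\<in>{0..1}. x)\<rparr>"

definition K_subgroup :: "nat \<Rightarrow> nat \<Rightarrow> (real \<Rightarrow> real) set" where
  "K_subgroup a b =
    {f \<in> carrier thompson_F.
      (\<exists>D (i::int). (f has_real_derivative D) (at 0 within {0..1}) \<and> log 2 D = of_int (int a * i)) \<and>
      (\<exists>D (i::int). (f has_real_derivative D) (at 1 within {0..1}) \<and> log 2 D = of_int (int b * i))}"


section \<open>Tree diagrams\<close>

datatype btree = Tip | Caret btree btree

text \<open>In binary words \<^const>\<open>False\<close> is the digit 0 (left child) and \<^const>\<open>True\<close> the digit 1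
  (right child).\<close>

primrec vertices :: "btree \<Rightarrow> bool list set" where
  "vertices Tip = {[]}"
| "vertices (Caret l r) = {[]} \<union> (#) False ` vertices l \<union> (#) True ` vertices r"

primrec leaves :: "btree \<Rightarrow> bool list list" where
  "leaves Tip = [[]]"
| "leaves (Caret l r) = map ((#) False) (leaves l) @ map ((#) True) (leaves r)"

definition binary_value :: "bool stream \<Rightarrow> real" where
  "binary_value s = (\<Sum>n. (if s !! n then 1 else 0) / 2 ^ Suc n)"

definition represents :: "btree \<Rightarrow> btree \<Rightarrow> (real \<Rightarrow> real) \<Rightarrow> bool" where
  "represents Tp Tm f \<longleftrightarrow>
    length (leaves Tp) = length (leaves Tm) \<and>
    (\<forall>k < length (leaves Tp). \<forall>\<gamma>.
      f (binary_value ((leaves Tp ! k) @- \<gamma>)) = binary_value ((leaves Tm ! k) @- \<gamma>))"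


section \<open>The planar 3-colorable subgroup\<close>

text \<open>The edge above a non-root vertex separates regions \<open>p\<close> and \<open>q\<close> when the leaves below the
  vertex are those numbered \<open>p + 1, \<dots>, q\<close> from the left, i.e. those with list indices
  \<open>p, \<dots>, q - 1\<close>.\<close>

definition edge_separates :: "btree \<Rightarrow> nat \<Rightarrow> nat \<Rightarrow> bool" where
  "edge_separates T p q \<longleftrightarrow>
    (\<exists>v \<in> vertices T. v \<noteq> [] \<and>
      {k. k < length (leaves T) \<and> prefix v (leaves T ! k)} = {p..<q})"

text \<open>The condition \<open>c 0 = c n\<close> expresses that the regions 0 and \<open>n\<close> are both the outer
  region; values of \<open>c\<close> beyond \<open>n\<close> are irrelevant.  The type \<open>3\<close> is the ring of integers
  modulo 3.\<close>

definition three_colorable :: "btree \<Rightarrow> btree \<Rightarrow> bool" where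
  "three_colorable Tp Tm \<longleftrightarrow>
    (\<exists>c :: nat \<Rightarrow> 3. c 0 = c (length (leaves Tp)) \<and>
      (\<forall>p q. edge_separates Tp p q \<or> edge_separates Tm p q \<longrightarrow> c p \<noteq> c q))"

definition planar_3col :: "(real \<Rightarrow> real) set" where
  "planar_3col =
    {f \<in> carrier thompson_F. \<exists>Tp Tm. represents Tp Tm f \<and> three_colorable Tp Tm}"

definition planar_3col_even :: "(real \<Rightarrow> real) set" where
  "planar_3col_even = planar_3col \<inter> K_subgroup 2 2"

end

theory Submission
  imports Defs
begin

text \<open>
  In a 3-coloring, the color differences across a vertex and across its two children are
  \<open>e, -e, -e\<close>, so a tree has a unique coloring up to the choice of \<open>e\<close> at the root, and the
  difference across a leaf \<open>w\<close> is \<open>e\<close> times the sign \<open>(-1) ^ (length w + hd w)\<close>.  A diagram is therefore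
  colorable iff the signs of all pairs of opposite leaves agree, or all disagree.  On the interval of such a
  leaf the slope of \<open>f\<close> is 2 to the difference of the leaf lengths and \<open>hd w\<close> tells
  whether the point is at least 1/2.  Writing \<open>twist f x\<close> for evenness of
  \<open>log 2 (f' x) + [x \<ge> 1/2] + [f x \<ge> 1/2]\<close>, the group \<open>\<E>\<close> consists of the \<open>f\<close> with constant twist,
  and the constant is the common parity of the slope exponents at 0 and 1.  Twist is a
  cocycle, so \<open>\<E>\<close> normalizes its even part.  Conversely, let \<open>g\<close> commensurate the even part, which contains
  \<open>p = x\<^sub>0\<^sup>2\<close>, a map with \<open>p x > x\<close> on \<open>(0,1)\<close>.  Some power \<open>q\<close> of \<open>p\<close> lies in the conjugate by \<open>g\<close>, which
  makes the twist of \<open>g\<close> invariant under \<open>q\<close>; as it is constant near 1 and \<open>q\<close> pushes every interior point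
  towards 1, it is constant.
\<close>

section \<open>Binary words as affine maps\<close>

text \<open>\<open>word_map w y\<close> has the binary expansion \<open>w\<close> followed by that
  of \<open>y\<close>, so \<open>word_map w\<close> carries [0,1] affinely onto the standard dyadic
  interval of the vertex \<open>w\<close>.\<close>

primrec word_map :: "bool list \<Rightarrow> real \<Rightarrow> real" where
  "word_map [] y = y"
| "word_map (b # w) y = (of_bool b + word_map w y) / 2"

lemma word_map_append: "word_map (u @ v) y = word_map u (word_map v y)"
  by (induction u) auto

lemma word_map_affine: "word_map w y = word_map w 0 + y / 2 ^ length w"
proof (induction w)
  case (Cons b w)
  show ?case
    using Cons.IH by (simp add: field_simps)
qed auto

lemma word_map_strict_mono: "word_map w x < word_map w y \<longleftrightarrow> x < y"
  by (induction w) auto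

lemma word_map_mono: "word_map w x \<le> word_map w y \<longleftrightarrow> x \<le> y"
  using word_map_strict_mono[of w y x] by linarith

lemma word_map_bounds: "y \<in> {0..1} \<Longrightarrow> word_map w y \<in> {0..1}"
  by (induction w) auto

lemma word_map_bounds_strict: "y \<in> {0<..<1} \<Longrightarrow> word_map w y \<in> {0<..<1}"
  by (induction w) auto

text \<open>The end points have to be left out: \<open>word_map [False] 1\<close> is 1/2 although
  the first digit is 0.\<close>

lemma word_map_half_le:
  assumes "w \<noteq> []" "y \<in> {0<..<1}"
  shows "1/2 \<le> word_map w y \<longleftrightarrow> hd w"
proof (cases w)
  case (Cons b v)
  then show ?thesis
    using word_map_bounds_strict[OF assms(2), of v] by auto
qed (use assms in auto)

lemma word_map_replicate_False: "word_map (replicate n False) y = y / 2 ^ n"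
  by (induction n) auto

lemma word_map_replicate_True: "word_map (replicate n True) y = 1 - (1 - y) / 2 ^ n"
  by (induction n) (auto simp: field_simps)

lemma word_map_at_integer: "\<exists>j::int. word_map w 0 = j / 2 ^ length w"
proof (induction w)
  case (Cons b w)
  then obtain j :: int where "word_map w 0 = j / 2 ^ length w" by auto
  then have "word_map (b # w) 0 = (of_bool b * 2 ^ length w + j :: int) / 2 ^ length (b # w)"
    by (auto simp: field_simps)
  then show ?case by blast
qed (auto intro: exI[of _ 0])

text \<open>The word is the binary expansion of \<open>j\<close> with \<open>M\<close> digits, most
  significant first. This recognizes the interval from j/2^M to (j+1)/2^M as that of a
  vertex.\<close>

lemma ex_word_map:
  assumes "0 \<le> j" "j < 2 ^ M"
  shows "\<exists>w. length w = M \<and> (\<forall>y. word_map w y = (of_int j + y) / 2 ^ M)"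
  using assms
proof (induction M arbitrary: j)
  case (Suc M)
  define b where "b = (2 ^ M \<le> j)"
  have "0 \<le> j - of_bool b * 2 ^ M" "j - of_bool b * 2 ^ M < 2 ^ M"
    using Suc.prems by (auto simp: b_def)
  from Suc.IH[OF this] obtain w where
    w: "length w = M" "\<And>y. word_map w y = (of_int (j - of_bool b * 2 ^ M) + y) / 2 ^ M"
    by blast
  then have "length (b # w) = Suc M \<and> (\<forall>y. word_map (b # w) y = (of_int j + y) / 2 ^ Suc M)"
    by (auto simp: field_simps)
  then show ?case by blast
qed auto

lemma ex_word_containing:
  assumes "x \<in> {0..1}"
  shows "\<exists>w y. length w = N \<and> y \<in> {0..1} \<and> x = word_map w y"
  using assms
proof (induction N arbitrary: x)
  case (Suc N)
  define b where "b = (1/2 \<le> x)"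
  have "2 * x - of_bool b \<in> {0..1}"
    using Suc.prems by (auto simp: b_def)
  from Suc.IH[OF this] obtain w y where
    w: "length w = N" "y \<in> {0..1}" "2 * x - of_bool b = word_map w y"
    by blast
  then have "length (b # w) = Suc N \<and> y \<in> {0..1} \<and> x = word_map (b # w) y"
    by auto
  then show ?case by blast
qed auto

section \<open>Binary expansions of the points of [0,1]\<close>

lemma binary_summable: "summable (\<lambda>n. (if s !! n then 1 else 0) / 2 ^ Suc n :: real)"
proof (rule summable_comparison_test')
  show "summable (\<lambda>n. (1/2) ^ Suc n :: real)"
    using power_half_series sums_summable by blast
qed (auto simp: field_simps)

lemma binary_value_Cons: "binary_value (b ## s) = (of_bool b + binary_value s) / 2"
proof -
  have "binary_value (b ## s) = (\<Sum>n. (if (b ## s) !! Suc n then 1 else 0) / 2 ^ Suc (Suc n) :: real) + of_bool b / 2"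
    unfolding binary_value_def
    by (subst suminf_split_head[OF binary_summable[of "b ## s"]]) auto
  also have "(\<Sum>n. (if (b ## s) !! Suc n then 1 else 0) / 2 ^ Suc (Suc n) :: real) = binary_value s / 2"
    unfolding binary_value_def
    by (subst suminf_divide[OF binary_summable, symmetric], rule suminf_cong) simp
  finally show ?thesis by simp
qed

lemma binary_value_shift: "binary_value (w @- s) = word_map w (binary_value s)"
  by (induction w) (auto simp: binary_value_Cons)

lemma binary_value_bounds: "binary_value s \<in> {0..1}"
proof -
  have "0 \<le> binary_value s"
    unfolding binary_value_def by (intro suminf_nonneg binary_summable) auto
  moreover have "binary_value s \<le> (\<Sum>n. (1/2) ^ Suc n :: real)"
    unfolding binary_value_def
    by (intro suminf_le binary_summable) (use power_half_series sums_summable in \<open>auto simp: field_simps\<close>)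
  ultimately show ?thesis
    using sums_unique[OF power_half_series] by simp
qed

primcorec binary_digits :: "real \<Rightarrow> bool stream" where
  "shd (binary_digits x) = (1/2 \<le> x)"
| "stl (binary_digits x) = binary_digits (2 * x - of_bool (1/2 \<le> x))"

text \<open>Reading off one digit halves the error, so the error is at most 1/2^n for every
  n.\<close>

lemma binary_value_digits:
  assumes "x \<in> {0..1}"
  shows "binary_value (binary_digits x) = x"
proof -
  have close: "\<bar>binary_value (binary_digits x) - x\<bar> \<le> 1 / 2 ^ n" if "x \<in> {0..1}" for n x
    using that
  proof (induction n arbitrary: x)
    case 0
    then show ?case
      using binary_value_bounds[of "binary_digits x"] by auto
  next
    case (Suc n)
    define z where "z = 2 * x - of_bool (1/2 \<le> x)"
    have "z \<in> {0..1}"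
      using Suc.prems by (auto simp: z_def)
    from Suc.IH[OF this] have "\<bar>binary_value (binary_digits z) - z\<bar> \<le> 1 / 2 ^ n" .
    moreover have "binary_value (binary_digits x) = (of_bool (1/2 \<le> x) + binary_value (binary_digits z)) / 2"
      by (subst binary_digits.code) (simp add: binary_value_Cons z_def)
    then have "binary_value (binary_digits x) - x = (binary_value (binary_digits z) - z) / 2"
      by (simp add: z_def field_simps)
    then have "\<bar>binary_value (binary_digits x) - x\<bar> = \<bar>binary_value (binary_digits z) - z\<bar> / 2"
      by (simp only: abs_divide abs_numeral)
    ultimately show ?case
      by simp
  qed
  have "\<bar>binary_value (binary_digits x) - x\<bar> \<le> 0"
  proof (rule LIMSEQ_le_const)
    show "(\<lambda>n. 1 / 2 ^ n :: real) \<longlonglongrightarrow> 0"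
      by (simp add: LIMSEQ_divide_realpow_zero)
  qed (use close assms in auto)
  then show ?thesis by simp
qed

text \<open>Since \<open>binary_value\<close> maps the streams onto [0,1], the infinite tails can be
  replaced by points of [0,1].\<close>

lemma represents_iff:
  "represents Tp Tm f \<longleftrightarrow> length (leaves Tp) = length (leaves Tm) \<and>
    (\<forall>k < length (leaves Tp). \<forall>y\<in>{0..1}. f (word_map (leaves Tp ! k) y) = word_map (leaves Tm ! k) y)"
proof -
  have "(\<forall>s. P (binary_value s)) \<longleftrightarrow> (\<forall>y\<in>{0..1}. P y)" for P
    using binary_value_bounds binary_value_digits by metis
  from this[of "\<lambda>y. f (word_map u y) = word_map v y" for u v] show ?thesis
    unfolding represents_def binary_value_shift by simp
qed


section \<open>Tilings of the unit interval\<close>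

text \<open>The intervals of consecutive words abut. Arbitrary ends \<open>a\<close> and
  \<open>b\<close> allow a tiling to be cut and to be treated one word at a time.\<close>

primrec tiles :: "real \<Rightarrow> real \<Rightarrow> bool list list \<Rightarrow> bool" where
  "tiles a b [] \<longleftrightarrow> a = b"
| "tiles a b (w # ws) \<longleftrightarrow> word_map w 0 = a \<and> tiles (word_map w 1) b ws"

lemma tiles_append: "tiles a b (us @ vs) \<longleftrightarrow> (\<exists>c. tiles a c us \<and> tiles c b vs)"
  by (induction us arbitrary: a) auto

lemma tiles_map_Cons: "tiles a b ws \<Longrightarrow> tiles ((of_bool d + a) / 2) ((of_bool d + b) / 2) (map ((#) d) ws)"
  by (induction ws arbitrary: a) auto

lemma tiles_map_Cons_iff:
  "tiles ((of_bool d + a) / 2) ((of_bool d + b) / 2) (map ((#) d) ws) \<longleftrightarrow> tiles a b ws"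
  by (induction ws arbitrary: a) auto

lemma tiles_leaves: "tiles 0 1 (leaves T)"
proof (induction T)
  case (Caret l r)
  from tiles_map_Cons[OF Caret.IH(1), of False] tiles_map_Cons[OF Caret.IH(2), of True]
  show ?case by (auto simp: tiles_append)
qed auto

lemma tiles_le: "tiles a b ws \<Longrightarrow> a \<le> b"
proof (induction ws arbitrary: a)
  case (Cons w ws)
  then have "word_map w 1 \<le> b" "a \<le> word_map w 1"
    using word_map_mono[of w 0 1] by auto
  then show ?case by linarith
qed auto

text \<open>The interval of the empty word fills [0,1], while any further word would need room of
  positive length beside it.\<close>

lemma tiles_nil_word:
  assumes "tiles a b ws" "[] \<in> set ws" "0 \<le> a" "b \<le> 1"
  shows "ws = [[]] \<and> a = 0"
proof -
  obtain us vs where ws: "ws = us @ [] # vs"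
    using assms(2) by (meson split_list)
  then have u: "tiles a 0 us" and v: "tiles 1 b vs"
    using assms(1) by (auto simp: tiles_append)
  have "us = []"
  proof (rule ccontr)
    assume "us \<noteq> []"
    then obtain u us' where "us = u # us'" by (cases us) auto
    then have "tiles (word_map u 1) 0 us'" "word_map u 0 = a"
      using u by auto
    then show False
      using tiles_le[of "word_map u 1" 0 us'] word_map_strict_mono[of u 0 1] assms(3) by auto
  qed
  moreover have "vs = []"
  proof (rule ccontr)
    assume "vs \<noteq> []"
    then obtain u us' where "vs = u # us'" by (cases vs) auto
    then have "tiles (word_map u 1) b us'" "word_map u 0 = 1"
      using v by auto
    then show False
      using tiles_le[of "word_map u 1" b us'] word_map_strict_mono[of u 0 1] assms(4) by auto
  qed
  ultimately show ?thesis
    using ws u by simp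
qed

text \<open>Among nonempty words, those starting with the digit 1 lie in the upper half, so a tiling
  lists them last; the tiling splits at 1/2.\<close>

lemma tiles_upper_half:
  assumes "tiles a b ws" "1/2 \<le> a" "b \<le> 1" "[] \<notin> set ws"
  shows "\<exists>vs. ws = map ((#) True) vs"
  using assms
proof (induction ws arbitrary: a)
  case (Cons w ws)
  then obtain d v where w: "w = d # v" by (cases w) auto
  have le: "word_map w 1 \<le> b" using Cons.prems tiles_le by auto
  have lt: "a < word_map w 1" using Cons.prems word_map_strict_mono[of w 0 1] by auto
  have d
    using word_map_bounds[of 1 v] lt Cons.prems(2) w by (cases d) auto
  obtain vs where "ws = map ((#) True) vs"
    using Cons.IH[of "word_map w 1"] Cons.prems lt by auto
  then have "w # ws = map ((#) True) (v # vs)" using w \<open>d\<close> by simp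
  then show ?case by (rule exI)
qed auto

text \<open>Words starting with the digit 0 are peeled off until the left end reaches 1/2. The left
  end \<open>a\<close> varies in this induction, and \<open>2 * a\<close> is its coordinate in the
  left half.\<close>

lemma tiles_split_half:
  assumes "tiles a 1 ws" "0 \<le> a" "a \<le> 1/2" "[] \<notin> set ws"
  shows "\<exists>us vs. ws = map ((#) False) us @ map ((#) True) vs \<and>
    tiles (2 * a) 1 us \<and> tiles 0 1 vs"
  using assms
proof (induction ws arbitrary: a)
  case (Cons w ws)
  then obtain d v where w: "w = d # v" by (cases w) auto
  have a: "a = (of_bool d + word_map v 0) / 2" using Cons.prems w by auto
  show ?case
  proof (cases d)
    case True
    then have "a = 1/2" "word_map v 0 = 0"
      using a Cons.prems word_map_bounds[of 0 v] by auto
    have "\<exists>vs. w # ws = map ((#) True) vs"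
      using tiles_upper_half[OF Cons.prems(1)] Cons.prems(4) \<open>a = 1/2\<close> by simp
    then obtain vs where vs: "w # ws = map ((#) True) vs" ..
    moreover have "tiles 0 1 vs"
      using tiles_map_Cons_iff[of True 0 1 vs] Cons.prems(1) \<open>a = 1/2\<close> unfolding vs by simp
    ultimately have "w # ws = map ((#) False) [] @ map ((#) True) vs \<and> tiles (2 * a) 1 [] \<and> tiles 0 1 vs"
      using \<open>a = 1/2\<close> by simp
    then show ?thesis by blast
  next
    case False
    have "tiles (word_map w 1) 1 ws" "word_map w 1 \<in> {0..1/2}"
      using Cons.prems w False word_map_bounds[of 1 v] by auto
    then obtain us vs where uv: "ws = map ((#) False) us @ map ((#) True) vs"
      "tiles (2 * word_map w 1) 1 us" "tiles 0 1 vs"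
      using Cons.IH[of "word_map w 1"] Cons.prems(4) by auto
    then have "w # ws = map ((#) False) (v # us) @ map ((#) True) vs \<and> tiles (2 * a) 1 (v # us) \<and> tiles 0 1 vs"
      using w False a by simp
    then show ?thesis by blast
  qed
qed auto

text \<open>Recursion on the maximal word length: a tiling without the empty word splits at 1/2 into
  tilings by shorter words, which become the two subtrees of a caret.\<close>

lemma tiles_obtain_tree:
  assumes "tiles 0 1 ws"
  obtains T where "leaves T = ws"
proof -
  have "\<exists>T. leaves T = ws" if "tiles 0 1 ws" "\<forall>w\<in>set ws. length w \<le> n" for n
    using that
  proof (induction n arbitrary: ws)
    case 0
    \<comment> \<open>All words have length 0, and there is at least one because 0 and 1
      differ.\<close>
    then have "[] \<in> set ws" by (cases ws) auto
    then have "ws = leaves Tip"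
      using tiles_nil_word[OF 0(1)] by auto
    then show ?case by metis
  next
    case (Suc n)
    show ?case
    proof (cases "[] \<in> set ws")
      case True
      then have "ws = leaves Tip"
        using tiles_nil_word[OF Suc.prems(1)] by auto
      then show ?thesis by metis
    next
      case False
      obtain us vs where uv: "ws = map ((#) False) us @ map ((#) True) vs"
        "tiles 0 1 us" "tiles 0 1 vs"
        using tiles_split_half[OF Suc.prems(1) _ _ False] by auto
      have "\<forall>w\<in>set us. length w \<le> n" "\<forall>w\<in>set vs. length w \<le> n"
        using Suc.prems(2) unfolding uv(1) by (simp_all add: ball_Un)
      then obtain l r where "leaves l = us" "leaves r = vs"
        using Suc.IH uv(2,3) by meson
      then have "leaves (Caret l r) = ws" using uv by simp
      then show ?thesis by blast
    qed
  qed
  from this[OF assms, of "Max (length ` set ws)"] that show ?thesis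
    by (meson Max_ge List.finite_set finite_imageI imageI)
qed

lemma tiles_map:
  assumes "tiles a b ws"
    and "\<And>w. w \<in> set ws \<Longrightarrow> word_map (h w) 0 = f (word_map w 0)"
    and "\<And>w. w \<in> set ws \<Longrightarrow> word_map (h w) 1 = f (word_map w 1)"
  shows "tiles (f a) (f b) (map h ws)"
  using assms by (induction ws arbitrary: a) auto

primrec full_tree :: "nat \<Rightarrow> btree" where
  "full_tree 0 = Tip"
| "full_tree (Suc n) = Caret (full_tree n) (full_tree n)"

lemma length_leaf_full_tree: "w \<in> set (leaves (full_tree n)) \<Longrightarrow> length w = n"
  by (induction n arbitrary: w) auto

text \<open>Read as a path from the root, a word at least as long as every leaf has to run through a
  leaf.\<close>

lemma ex_leaf_prefix:
  assumes "\<And>u. u \<in> set (leaves T) \<Longrightarrow> length u \<le> length w"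
  shows "\<exists>k < length (leaves T). prefix (leaves T ! k) w"
proof -
  have "\<exists>u\<in>set (leaves T). prefix u w"
    using assms
  proof (induction T arbitrary: w)
    case (Caret l r)
    have "leaves l \<noteq> []" "leaves r \<noteq> []"
      using tiles_leaves[of l] tiles_leaves[of r] by auto
    then have "0 < length w"
      using Caret.prems[of "False # hd (leaves l)"] by auto
    then obtain d v where w: "w = d # v" by (cases w) auto
    show ?case
    proof (cases d)
      case True
      have "length u \<le> length v" if "u \<in> set (leaves r)" for u
        using Caret.prems[of "True # u"] that w by auto
      then show ?thesis
        using Caret.IH(2)[of v] w True by (auto simp: bex_Un)
    next
      case False
      have "length u \<le> length v" if "u \<in> set (leaves l)" for u
        using Caret.prems[of "False # u"] that w by auto
      then show ?thesis
        using Caret.IH(1)[of v] w False by (auto simp: bex_Un)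
    qed
  qed auto
  then show ?thesis by (metis in_set_conv_nth)
qed

section \<open>Thompson's group as maps between dyadic intervals\<close>

text \<open>The eventual form provides a common denominator for finitely many dyadic rationals at
  once.\<close>

lemma dyadic_rationals_iff: "x \<in> dyadic_rationals \<longleftrightarrow> (\<forall>\<^sub>F n in sequentially. 2 ^ n * x \<in> \<int>)"
proof
  assume "x \<in> dyadic_rationals"
  then obtain m :: int and n :: nat where x: "x = m / 2 ^ n"
    by (auto simp: dyadic_rationals_def)
  have "2 ^ k * x \<in> \<int>" if "n \<le> k" for k
  proof -
    have "(2::real) ^ k = 2 ^ (k - n) * 2 ^ n"
      using that by (simp flip: power_add)
    then have "2 ^ k * x = of_int (2 ^ (k - n) * m)"
      by (simp add: x)
    then show ?thesis by (metis Ints_of_int)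
  qed
  then show "\<forall>\<^sub>F n in sequentially. 2 ^ n * x \<in> \<int>"
    by (auto simp: eventually_sequentially)
next
  assume "\<forall>\<^sub>F n in sequentially. 2 ^ n * x \<in> \<int>"
  then obtain n where "2 ^ n * x \<in> \<int>"
    by (auto simp: eventually_sequentially)
  then obtain m :: int where "2 ^ n * x = m" by (auto elim: Ints_cases)
  then have "x = m / 2 ^ n" by (simp add: field_simps)
  then show "x \<in> dyadic_rationals" by (auto simp: dyadic_rationals_def)
qed

lemma dyadic_rationals_add:
  assumes "x \<in> dyadic_rationals" "y \<in> dyadic_rationals"
  shows "x + y \<in> dyadic_rationals"
  using assms[unfolded dyadic_rationals_iff] unfolding dyadic_rationals_iff
  by eventually_elim (simp add: distrib_left)

lemma dyadic_rationals_powi: "2 powi k \<in> dyadic_rationals"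
proof -
  have "2 ^ n * 2 powi k \<in> (\<int> :: real set)" if "nat (- k) \<le> n" for n
  proof -
    have "2 ^ n * 2 powi k = (2 powi (int n + k) :: real)"
      by (simp add: power_int_add)
    also have "\<dots> = 2 ^ nat (int n + k)"
      using that by (simp add: power_int_def)
    finally show ?thesis by simp
  qed
  then show ?thesis
    unfolding dyadic_rationals_iff eventually_sequentially by blast
qed

lemma dyadic_rationals_word_map:
  assumes "y \<in> {0, 1}"
  shows "word_map w y \<in> dyadic_rationals"
proof -
  obtain j :: int where "word_map w 0 = j / 2 ^ length w"
    using word_map_at_integer by blast
  then have "word_map w y = of_int j / 2 ^ length w \<or> word_map w y = of_int (j + 1) / 2 ^ length w"
    using assms word_map_affine[of w y] by (auto simp: add_divide_distrib)
  then show ?thesis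
    unfolding dyadic_rationals_def by blast
qed

lemma set_leaves_full_tree: "set (leaves (full_tree n)) = {w. length w = n}"
proof (intro equalityI subsetI CollectI)
  fix w :: "bool list" assume "w \<in> {w. length w = n}"
  then have w: "length w = n" by simp
  obtain k where k: "k < length (leaves (full_tree n))" "prefix (leaves (full_tree n) ! k) w"
    using ex_leaf_prefix[of "full_tree n" w] length_leaf_full_tree w by fastforce
  then have "leaves (full_tree n) ! k = w"
    using length_leaf_full_tree[OF nth_mem[OF k(1)]] w
    by (metis append_eq_conv_conj prefixE take_all order_refl)
  then show "w \<in> set (leaves (full_tree n))"
    using k(1) nth_mem by force
qed (simp add: length_leaf_full_tree)

lemma finite_words: "finite {w :: bool list. length w = n}"
  using set_leaves_full_tree[of n] by (metis List.finite_set)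

text \<open>The pieces are closed intervals, so neighbouring affine formulas agree at the common
  end, and both properties glue there. The induction cuts at 1/2.\<close>

lemma continuous_strict_mono_pieces:
  assumes "\<And>w. length w = N \<Longrightarrow> \<exists>c d. 0 < d \<and> (\<forall>y\<in>{0..1}. f (word_map w y) = c + d * y)"
  shows "continuous_on {0..1} f \<and> strict_mono_on {0..1} f"
  using assms
proof (induction N arbitrary: f)
  case 0
  then obtain c d where cd: "0 < d" "\<And>y. y \<in> {0..1} \<Longrightarrow> f y = c + d * y"
    by auto
  have "continuous_on {0..1} (\<lambda>y. c + d * y)"
    by (intro continuous_intros)
  then have "continuous_on {0..1} f"
    using cd(2) by (subst continuous_on_cong[OF refl]) auto
  moreover have "strict_mono_on {0..1} f"
    using cd by (auto simp: strict_mono_on_def)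
  ultimately show ?case by blast
next
  case (Suc N)
  \<comment> \<open>Each half of \<open>f\<close>, rescaled to [0,1], is affine on the intervals of
    level \<open>N\<close>.\<close>
  have half: "continuous_on {0..1} (\<lambda>y. f ((of_bool b + y) / 2)) \<and>
      strict_mono_on {0..1} (\<lambda>y. f ((of_bool b + y) / 2))" for b
    by (rule Suc.IH) (use Suc.prems[of "b # _"] in auto)
  have im: "(\<lambda>x. 2 * x) ` {0..1/2} \<subseteq> {0..1::real}" "(\<lambda>x. 2 * x - 1) ` {1/2..1} \<subseteq> {0..1::real}"
    by auto
  have "continuous_on {0..1/2} ((\<lambda>y. f ((of_bool False + y) / 2)) \<circ> (\<lambda>x. 2 * x))"
    using half[of False] im(1)
    by (intro continuous_on_compose continuous_intros) (blast intro: continuous_on_subset)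
  then have cl: "continuous_on {0..1/2} f"
    by (rule continuous_on_cong[THEN iffD1, rotated -1]) auto
  have "continuous_on {1/2..1} ((\<lambda>y. f ((of_bool True + y) / 2)) \<circ> (\<lambda>x. 2 * x - 1))"
    using half[of True] im(2)
    by (intro continuous_on_compose continuous_intros) (blast intro: continuous_on_subset)
  then have cr: "continuous_on {1/2..1} f"
    by (rule continuous_on_cong[THEN iffD1, rotated -1]) auto
  have "{0..1/2} \<union> {1/2..1} = {0..1::real}" by auto
  then have "continuous_on {0..1} f"
    using continuous_on_closed_Un[OF _ _ cl cr] by simp
  moreover have ml: "f x < f y" if "0 \<le> x" "x < y" "y \<le> 1/2" for x y
    using strict_mono_onD[OF conjunct2[OF half[of False]], of "2 * x" "2 * y"] that by simp
  have mr: "f x < f y" if "1/2 \<le> x" "x < y" "y \<le> 1" for x y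
    using strict_mono_onD[OF conjunct2[OF half[of True]], of "2 * x - 1" "2 * y - 1"] that by simp
  have "strict_mono_on {0..1} f"
  proof (rule strict_mono_onI)
    fix x y :: real assume xy: "x \<in> {0..1}" "y \<in> {0..1}" "x < y"
    consider "y \<le> 1/2" | "1/2 \<le> x" | "x < 1/2" "1/2 < y" by linarith
    then show "f x < f y"
    proof cases
      case 3
      then show ?thesis using ml[of x "1/2"] mr[of "1/2" y] xy by simp
    qed (use ml mr xy in auto)
  qed
  ultimately show ?case by blast
qed

text \<open>Every standard dyadic interval of level \<open>N\<close> goes affinely onto a standard
  dyadic interval, possibly of another level: a prefix replacement.\<close>

definition dyadic_map :: "(real \<Rightarrow> real) \<Rightarrow> nat \<Rightarrow> bool" where
  "dyadic_map f N \<longleftrightarrow> (\<forall>w. length w = N \<longrightarrow> (\<exists>v. \<forall>y\<in>{0..1}. f (word_map w y) = word_map v y))"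

lemma dyadic_map_continuous_strict_mono:
  assumes "dyadic_map f N"
  shows "continuous_on {0..1} f \<and> strict_mono_on {0..1} f"
proof (rule continuous_strict_mono_pieces)
  fix w :: "bool list" assume "length w = N"
  then obtain v where v: "\<And>y. y \<in> {0..1} \<Longrightarrow> f (word_map w y) = word_map v y"
    using assms by (auto simp: dyadic_map_def)
  have "0 < 1 / (2::real) ^ length v \<and> (\<forall>y\<in>{0..1}. f (word_map w y) = word_map v 0 + 1 / 2 ^ length v * y)"
    using v by (simp add: word_map_affine[symmetric])
  then show "\<exists>c d. 0 < d \<and> (\<forall>y\<in>{0..1}. f (word_map w y) = c + d * y)" by blast
qed

lemma dyadic_map_image:
  assumes "dyadic_map f N" "f 0 = 0" "f 1 = 1"
  shows "f ` {0..1} = {0..1}" "inj_on f {0..1}"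
proof -
  have f: "continuous_on {0..1} f" "strict_mono_on {0..1} f"
    using dyadic_map_continuous_strict_mono[OF assms(1)] by auto
  then show "inj_on f {0..1}" by (simp add: strict_mono_on_imp_inj_on)
  show "f ` {0..1} = {0..1}"
  proof
    show "f ` {0..1} \<subseteq> {0..1}"
      using strict_mono_on_leD[OF f(2), of 0] strict_mono_on_leD[OF f(2), of _ 1] assms by auto
    show "{0..1} \<subseteq> f ` {0..1}"
      using IVT'[of f 0 _ 1] f(1) assms by (force simp: image_iff)
  qed
qed

definition has_slope :: "(real \<Rightarrow> real) \<Rightarrow> real \<Rightarrow> int \<Rightarrow> bool" where
  "has_slope f x k \<longleftrightarrow> (f has_real_derivative 2 powi k) (at x within {0..1})"

lemma has_slopeI:
  assumes "a \<in> {0..1}" "0 < d" "\<And>x. x \<in> {0..1} \<Longrightarrow> \<bar>x - a\<bar> < d \<Longrightarrow> f x = c + 2 powi k * x"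
  shows "has_slope f a k"
  unfolding has_slope_def
proof (rule has_field_derivative_transform_within)
  show "((\<lambda>x. c + 2 powi k * x) has_real_derivative 2 powi k) (at a within {0..1})"
    by (auto intro!: derivative_eq_intros)
qed (use assms in \<open>auto simp: dist_real_def\<close>)

text \<open>Every point of [0,1], the ends included, is a limit point of [0,1], so one-sided
  derivatives at the ends are unique as well.\<close>

lemma unit_derivative_unique:
  fixes D E :: real
  assumes "(f has_real_derivative D) (at x within {0..1})" "(f has_real_derivative E) (at x within {0..1})"
    and "x \<in> {0..1}"
  shows "D = E"
proof -
  have "x islimpt {0..1}"
    using assms(3) by (simp add: islimpt_Icc)
  then have "at x within {0..1} \<noteq> bot"
    by (simp add: trivial_limit_within)
  then show ?thesis
    using assms(1,2) tendsto_unique unfolding has_field_derivative_iff by blast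
qed

lemma has_slope_unique: "has_slope f x k \<Longrightarrow> has_slope f x l \<Longrightarrow> x \<in> {0..1} \<Longrightarrow> k = l"
  using unit_derivative_unique[of f "2 powi k" x "2 powi l"] power_int_strict_increasing[of k l "2::real"]
    power_int_strict_increasing[of l k "2::real"]
  by (cases k l rule: linorder_cases) (auto simp: has_slope_def)

text \<open>An interval of length 2^-|w| goes onto one of length 2^-|v|, which gives the
  slope.\<close>

lemma word_piece_affine:
  assumes "\<And>y. y \<in> {0..1} \<Longrightarrow> f (word_map w y) = word_map v y"
  shows "\<exists>c. \<forall>x\<in>{word_map w 0..word_map w 1}. f x = c + 2 powi (int (length w) - int (length v)) * x"
proof -
  have pow: "2 powi (int (length w) - int (length v)) = (2 ^ length w / 2 ^ length v :: real)"
    by (simp add: power_int_diff)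
  have "f x = (word_map v 0 - 2 ^ length w / 2 ^ length v * word_map w 0) + 2 ^ length w / 2 ^ length v * x"
    if "x \<in> {word_map w 0..word_map w 1}" for x
  proof -
    define y where "y = (x - word_map w 0) * 2 ^ length w"
    have "y \<in> {0..1}" "word_map w y = x"
      using that word_map_affine[of w 1] word_map_affine[of w y] by (auto simp: y_def field_simps)
    then have "f x = word_map v y" using assms by metis
    then show ?thesis using word_map_affine[of v y] by (simp add: y_def field_simps)
  qed
  then show ?thesis unfolding pow by blast
qed

text \<open>Only interior points are covered, since the slope may jump at the ends of the
  interval.\<close>

lemma has_slope_word:
  assumes "\<And>y. y \<in> {0..1} \<Longrightarrow> f (word_map w y) = word_map v y"
    and "x \<in> {word_map w 0<..<word_map w 1}"
  shows "has_slope f x (int (length w) - int (length v))"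
proof -
  obtain c where c: "\<And>x. x \<in> {word_map w 0..word_map w 1} \<Longrightarrow>
      f x = c + 2 powi (int (length w) - int (length v)) * x"
    using word_piece_affine[OF assms(1)] by blast
  show ?thesis
  proof (rule has_slopeI[where d = "min (x - word_map w 0) (word_map w 1 - x)" and c = c])
    show "x \<in> {0..1}"
      using assms(2) word_map_bounds[of 0 w] word_map_bounds[of 1 w] by auto
    fix t assume "\<bar>t - x\<bar> < min (x - word_map w 0) (word_map w 1 - x)"
    then have "t \<in> {word_map w 0..word_map w 1}" unfolding atLeastAtMost_iff by linarith
    then show "f t = c + 2 powi (int (length w) - int (length v)) * t" by (rule c)
  qed (use assms(2) in auto)
qed

lemma ex_word_interior:
  assumes "x \<in> {0..1} - (\<Union>w\<in>{w. length w = N}. {word_map w 0, word_map w 1})"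
  shows "\<exists>w. length w = N \<and> x \<in> {word_map w 0<..<word_map w 1}"
proof -
  obtain w y where w: "length w = N" "y \<in> {0..1}" "x = word_map w y"
    using ex_word_containing[of x N] assms by blast
  then have "y \<noteq> 0" "y \<noteq> 1" using assms by auto
  then show ?thesis
    using w word_map_strict_mono[of w 0 y] word_map_strict_mono[of w y 1] by auto
qed

lemma dyadic_map_in_carrier:
  assumes "f \<in> extensional {0..1}" "f 0 = 0" "f 1 = 1" "dyadic_map f N"
  shows "f \<in> carrier thompson_F"
proof -
  define S where "S = (\<Union>w\<in>{w. length w = N}. {word_map w 0, word_map w 1})"
  have "finite S"
    unfolding S_def by (intro finite_UN_I finite_words) auto
  have ex_inv: "\<exists>g. homeomorphism {0..1} {0..1} f g"
    using dyadic_map_image[OF assms(4,2,3)] dyadic_map_continuous_strict_mono[OF assms(4)]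
    by (intro homeomorphism_compact) auto
  have pl: "piecewise_linear f"
    unfolding piecewise_linear_def
  proof (intro exI[of _ S] conjI allI impI)
    fix a b :: real assume ab: "0 \<le> a \<and> a < b \<and> b \<le> 1 \<and> {a<..<b} \<inter> S = {}"
    \<comment> \<open>The midpoint selects the word interval that contains all of (a,b): its ends
      belong to \<open>S\<close> and so cannot lie inside (a,b).\<close>
    then have "(a + b) / 2 \<in> {a<..<b}" by simp
    then have "(a + b) / 2 \<notin> S" using ab by (auto simp only: disjoint_iff)
    moreover have "(a + b) / 2 \<in> {0..1}" using ab by simp
    ultimately have mid: "(a + b) / 2 \<in> {0..1} - S" by (rule DiffI[rotated])
    obtain w where w: "length w = N" "(a + b) / 2 \<in> {word_map w 0<..<word_map w 1}"
      using ex_word_interior[OF mid[unfolded S_def]] by (elim exE conjE)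
    then have "word_map w 0 \<in> S" "word_map w 1 \<in> S" unfolding S_def by blast+
    then have "word_map w 0 \<notin> {a<..<b}" "word_map w 1 \<notin> {a<..<b}" using ab by blast+
    moreover have "word_map w 0 < b" "a < word_map w 1" using w(2) ab by auto
    ultimately have "word_map w 0 \<le> a" "b \<le> word_map w 1" by auto
    then have sub: "{a<..<b} \<subseteq> {word_map w 0..word_map w 1}" by force
    obtain v where "\<And>y. y \<in> {0..1} \<Longrightarrow> f (word_map w y) = word_map v y"
      using assms(4) w(1) by (auto simp: dyadic_map_def)
    from word_piece_affine[OF this] obtain c where
      "\<forall>x\<in>{word_map w 0..word_map w 1}. f x = c + 2 powi (int (length w) - int (length v)) * x" ..
    with sub have "\<forall>x\<in>{a<..<b}. f x = 2 powi (int (length w) - int (length v)) * x + c"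
      by (metis add.commute subsetD)
    then show "\<exists>m c. \<forall>x\<in>{a<..<b}. f x = m * x + c"
      by (intro exI[of _ c] exI[of _ "2 powi (int (length w) - int (length v))"])
  qed (fact \<open>finite S\<close>)
  have "\<exists>k::int. (f has_real_derivative 2 powi k) (at x within {0..1})" if x: "x \<in> {0..1} - S" for x
  proof -
    obtain w where w: "length w = N" "x \<in> {word_map w 0<..<word_map w 1}"
      using ex_word_interior[OF x[unfolded S_def]] by (elim exE conjE)
    obtain v where "\<And>y. y \<in> {0..1} \<Longrightarrow> f (word_map w y) = word_map v y"
      using assms(4) w(1) by (auto simp: dyadic_map_def)
    from has_slope_word[OF this w(2)] show ?thesis unfolding has_slope_def by blast
  qed
  moreover have "S \<subseteq> dyadic_rationals"
    unfolding S_def using dyadic_rationals_word_map by fast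
  ultimately have "\<exists>S. finite S \<and> S \<subseteq> dyadic_rationals \<and> (\<forall>x\<in>{0..1} - S. \<exists>k::int.
      (f has_real_derivative 2 powi k) (at x within {0..1}))"
    using \<open>finite S\<close> by blast
  with ex_inv pl show ?thesis
    using assms(1) unfolding thompson_F_def by simp
qed

section \<open>Darboux's theorem, and maps whose slopes are powers of 2\<close>

lemma derivative_intermediate_value:
  fixes f :: "real \<Rightarrow> real"
  assumes "x < y" "\<And>t. t \<in> {x..y} \<Longrightarrow> (f has_real_derivative D t) (at t)"
    and "D x < m" "m < D y"
  shows "\<exists>t\<in>{x..y}. D t = m"
proof -
  \<comment> \<open>The derivative of \<open>g\<close> is negative at \<open>x\<close> and positive
    at \<open>y\<close>, so the minimum of \<open>g\<close> on [x,y] is attained inside, where the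
    derivative vanishes.\<close>
  define g where "g = (\<lambda>t. f t - m * t)"
  have dg: "(g has_real_derivative D t - m) (at t)" if "t \<in> {x..y}" for t
    unfolding g_def using assms(2)[OF that] by (auto intro!: derivative_eq_intros)
  have "continuous_on {x..y} g"
    using dg by (meson DERIV_continuous continuous_at_imp_continuous_on)
  then obtain t where t: "t \<in> {x..y}" "\<And>s. s \<in> {x..y} \<Longrightarrow> g t \<le> g s"
    using continuous_attains_inf[of "{x..y}" g] assms(1) by auto
  have "t \<noteq> x"
  proof
    assume "t = x"
    obtain d where d: "0 < d" "\<And>h. 0 < h \<Longrightarrow> h < d \<Longrightarrow> g (x + h) < g x"
      using DERIV_neg_dec_right[OF dg[of x]] assms by auto
    define h where "h = min (d / 2) (y - x)"
    have "0 < h" "h < d" "x + h \<in> {x..y}" using d(1) assms(1) by (auto simp: h_def)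
    then show False using d(2)[of h] t(2)[of "x + h"] \<open>t = x\<close> by simp
  qed
  moreover have "t \<noteq> y"
  proof
    assume "t = y"
    obtain d where d: "0 < d" "\<And>h. 0 < h \<Longrightarrow> h < d \<Longrightarrow> g (y - h) < g y"
      using DERIV_pos_inc_left[OF dg[of y]] assms by auto
    define h where "h = min (d / 2) (y - x)"
    have "0 < h" "h < d" "y - h \<in> {x..y}" using d(1) assms(1) by (auto simp: h_def)
    then show False using d(2)[of h] t(2)[of "y - h"] \<open>t = y\<close> by simp
  qed
  ultimately have "x < t" "t < y" using t(1) by auto
  have "D t - m = 0"
  proof (rule DERIV_local_min[OF dg[OF t(1)]])
    show "0 < min (t - x) (y - t)" using \<open>x < t\<close> \<open>t < y\<close> by simp
    show "\<forall>s. \<bar>t - s\<bar> < min (t - x) (y - t) \<longrightarrow> g t \<le> g s"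
    proof (intro allI impI t(2))
      fix s assume "\<bar>t - s\<bar> < min (t - x) (y - t)"
      then show "s \<in> {x..y}" unfolding atLeastAtMost_iff by linarith
    qed
  qed
  then show ?thesis using t(1) by auto
qed

text \<open>A derivative has the intermediate value property, so it cannot jump across the gap
  between two powers of 2.\<close>

lemma powi_derivative_const:
  fixes f :: "real \<Rightarrow> real"
  assumes "x < y" "\<And>t. t \<in> {x..y} \<Longrightarrow> (f has_real_derivative 2 powi k t) (at t)"
  shows "k x = k y"
proof (rule ccontr)
  assume ne: "k x \<noteq> k y"
  \<comment> \<open>With factor 3/2, \<open>m\<close> lies strictly between the smaller of the two
    slopes and the next power of 2.\<close>
  define m where "m = 2 powi (min (k x) (k y)) * (3/2 :: real)"
  define l where "l = min (k x) (k y)"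
  have less: "2 powi l < m \<and> m < 2 powi j" if "l < j" for j
  proof -
    have "(2 powi (l + 1) :: real) \<le> 2 powi j"
      using that by (intro power_int_increasing) auto
    moreover have "(2 powi (l + 1) :: real) = 2 * 2 powi l" "(0::real) < 2 powi l"
      by (auto simp: power_int_add)
    ultimately show ?thesis unfolding m_def l_def[symmetric] by linarith
  qed
  have gap: "2 powi j \<noteq> m" for j
  proof (cases "j \<le> l")
    case True
    then have "2 powi j \<le> (2 powi l :: real)" by (intro power_int_increasing) auto
    then show ?thesis using less[of "l + 1"] by linarith
  next
    case False
    then show ?thesis using less[of j] by simp
  qed
  show False
  proof (cases "k x < k y")
    case True
    then show False
      using derivative_intermediate_value[OF assms, of m] less[of "k y"] gap by (auto simp: l_def)
  next
    case False
    then have "k y < k x" using ne by simp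
    \<comment> \<open>The intermediate value lemma treats a derivative that grows from
      \<open>x\<close> to \<open>y\<close>, so it is applied to the negative of
      \<open>f\<close>.\<close>
    have "\<exists>t\<in>{x..y}. - (2 powi k t) = - m"
    proof (rule derivative_intermediate_value[OF assms(1)])
      show "((\<lambda>t. - f t) has_real_derivative - (2 powi k t)) (at t)" if "t \<in> {x..y}" for t
        using assms(2)[OF that] by (rule DERIV_minus)
    qed (use less[of "k x"] \<open>k y < k x\<close> in \<open>auto simp: l_def\<close>)
    then show False using gap by auto
  qed
qed

text \<open>The slope exponent is constant inside. After subtracting the linear part the derivative
  is 0, and continuity carries the formula to the ends.\<close>

lemma powi_slope_affine:
  fixes f :: "real \<Rightarrow> real"
  assumes "a < b" "continuous_on {a..b} f"
    and "\<And>t. t \<in> {a<..<b} \<Longrightarrow> \<exists>k::int. (f has_real_derivative 2 powi k) (at t)"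
  shows "\<exists>k::int. \<forall>t\<in>{a..b}. f t = f a + 2 powi k * (t - a)"
proof -
  obtain k where k: "\<And>t. t \<in> {a<..<b} \<Longrightarrow> (f has_real_derivative 2 powi (k t)) (at t)"
    using assms(3) by metis
  obtain c where c: "c \<in> {a<..<b}" using dense[OF assms(1)] by auto
  define j where "j = k c"
  have const: "k s = k t" if "s \<in> {a<..<b}" "t \<in> {a<..<b}" "s < t" for s t
    using that by (intro powi_derivative_const[where f = f and k = k] k) auto
  have kj: "k t = j" if "t \<in> {a<..<b}" for t
    using const[OF that c] const[OF c that] unfolding j_def by (metis linorder_cases)
  define g where "g = (\<lambda>t. f t - 2 powi j * t)"
  have "g t = g a" if "t \<in> {a..b}" for t
  proof (rule DERIV_isconst2[OF assms(1)])
    show "continuous_on {a..b} g"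
      unfolding g_def by (intro continuous_on_diff continuous_on_const continuous_on_mult continuous_on_id assms(2))
    show "DERIV g s :> 0" if "a < s" "s < b" for s
    proof -
      have "(f has_real_derivative 2 powi j) (at s)"
        using k[of s] kj[of s] that by simp
      from DERIV_diff[OF this DERIV_cmult_Id[of "2 powi j"]] show ?thesis
        unfolding g_def by simp
    qed
  qed (use that in simp_all)
  then have "f t - 2 powi j * t = f a - 2 powi j * a" if "t \<in> {a..b}" for t
    unfolding g_def using that by blast
  then have "f t = f a + 2 powi j * (t - a)" if "t \<in> {a..b}" for t
    unfolding right_diff_distrib using that by fastforce
  then show ?thesis by blast
qed

text \<open>From left to right, each tile adds a power of 2 to the value of
  \<open>f\<close>.\<close>

lemma tiles_dyadic_values:
  assumes "tiles a b ws" "f a \<in> dyadic_rationals"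
    and "\<And>w. w \<in> set ws \<Longrightarrow> \<exists>k. f (word_map w 1) = f (word_map w 0) + 2 powi k"
  shows "\<forall>w\<in>set ws. f (word_map w 0) \<in> dyadic_rationals"
  using assms
proof (induction ws arbitrary: a)
  case (Cons w ws)
  have "f (word_map w 1) \<in> dyadic_rationals"
    using Cons.prems dyadic_rationals_add dyadic_rationals_powi by fastforce
  then show ?case using Cons by auto
qed auto

lemma carrier_affine_pieces:
  assumes "f \<in> carrier thompson_F"
  shows "\<exists>N. \<forall>w. length w = N \<longrightarrow>
    (\<exists>k::int. \<forall>y\<in>{0..1}. f (word_map w y) = f (word_map w 0) + 2 powi k * y)"
proof -
  obtain S where S: "finite S" "S \<subseteq> dyadic_rationals"
    and slope: "\<And>x. x \<in> {0..1} - S \<Longrightarrow> \<exists>k::int. (f has_real_derivative 2 powi k) (at x within {0..1})"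
  proof -
    have "\<exists>S. finite S \<and> S \<subseteq> dyadic_rationals \<and> (\<forall>x\<in>{0..1} - S. \<exists>k::int.
        (f has_real_derivative 2 powi k) (at x within {0..1}))"
      using assms by (simp add: thompson_F_def)
    then show ?thesis using that by meson
  qed
  have cont: "continuous_on {0..1} f"
  proof -
    have "\<exists>g. homeomorphism {0..1} {0..1} f g"
      using assms by (simp add: thompson_F_def)
    then show ?thesis by (auto simp: homeomorphism_def)
  qed
  \<comment> \<open>\<open>N\<close> is chosen so that all exceptional points are multiples of 2^-N;
    then none lies strictly inside a word interval of level \<open>N\<close>.\<close>
  have "\<forall>\<^sub>F n in sequentially. \<forall>s\<in>S. 2 ^ n * s \<in> \<int>"
    using S dyadic_rationals_iff by (intro eventually_ball_finite) auto
  then obtain N where N: "\<And>s. s \<in> S \<Longrightarrow> 2 ^ N * s \<in> \<int>"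
    by (auto simp: eventually_sequentially)
  have "\<exists>k::int. \<forall>y\<in>{0..1}. f (word_map w y) = f (word_map w 0) + 2 powi k * y"
    if w: "length w = N" for w
  proof -
    define a b where "a = word_map w 0" and "b = word_map w 1"
    have ab: "a < b" "0 \<le> a" "b \<le> 1" "b = a + 1 / 2 ^ N"
      using word_map_strict_mono[of w 0 1] word_map_bounds[of 0 w] word_map_bounds[of 1 w]
        word_map_affine[of w 1] w by (auto simp: a_def b_def)
    obtain j :: int where j: "a = j / 2 ^ N"
      using word_map_at_integer[of w] w by (auto simp: a_def)
    have "t \<notin> S" if "t \<in> {a<..<b}" for t
    proof
      assume "t \<in> S"
      then obtain i :: int where "2 ^ N * t = i" using N by (auto elim: Ints_cases)
      moreover have "j < 2 ^ N * t" "2 ^ N * t < j + 1"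
        using that ab j by (auto simp: field_simps)
      ultimately have "real_of_int j < real_of_int i" "real_of_int i < real_of_int (j + 1)" by simp_all
      then have "j < i" "i < j + 1" by (simp_all only: of_int_less_iff)
      then show False by linarith
    qed
    then have "\<exists>k::int. (f has_real_derivative 2 powi k) (at t)" if "t \<in> {a<..<b}" for t
      using slope[of t] that ab at_within_interior[of t "{0..1}"] by auto
    then obtain k :: int where k: "\<And>t. t \<in> {a..b} \<Longrightarrow> f t = f a + 2 powi k * (t - a)"
      using powi_slope_affine[of a b f] ab(1) continuous_on_subset[OF cont, of "{a..b}"] ab(2,3)
      by (auto simp del: atLeastAtMost_iff)
    \<comment> \<open>The exponent drops by \<open>N\<close> because \<open>y\<close> is the
      coordinate on an interval of length 2^-N rescaled to [0,1].\<close>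
    have "f (word_map w y) = f (word_map w 0) + 2 powi (k - int N) * y" if "y \<in> {0..1}" for y
    proof -
      have "word_map w y \<in> {a..b}"
        using that word_map_mono[of w 0 y] word_map_mono[of w y 1] by (auto simp: a_def b_def)
      from k[OF this] show ?thesis
        using word_map_affine[of w y] w by (simp add: a_def power_int_diff)
    qed
    then show ?thesis by blast
  qed
  then show ?thesis by blast
qed

text \<open>On a sufficiently fine level an element is affine with power-of-2 slopes and dyadic
  values. Subdividing further makes every image a standard dyadic interval and not merely one with
  dyadic ends.\<close>

theorem carrier_thompson_F:
  "f \<in> carrier thompson_F \<longleftrightarrow> f \<in> extensional {0..1} \<and> f 0 = 0 \<and> f 1 = 1 \<and> (\<exists>N. dyadic_map f N)"
proof (intro iffI conjI)
  assume f: "f \<in> carrier thompson_F"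
  then show "f \<in> extensional {0..1}" by (auto simp: thompson_F_def)
  obtain g where "homeomorphism {0..1} {0..1} f g"
    using f unfolding thompson_F_def by auto
  then have surj: "f ` {0..1} = {0..1}" by (simp add: homeomorphism_def)
  obtain N where N: "\<And>w. length w = N \<Longrightarrow>
      \<exists>k::int. \<forall>y\<in>{0..1}. f (word_map w y) = f (word_map w 0) + 2 powi k * y"
    using carrier_affine_pieces[OF f] by blast
  have mono: "strict_mono_on {0..1} f"
  proof (rule conjunct2[OF continuous_strict_mono_pieces])
    fix w :: "bool list" assume "length w = N"
    from N[OF this] obtain k :: int where
      "\<forall>y\<in>{0..1}. f (word_map w y) = f (word_map w 0) + 2 powi k * y" by blast
    moreover have "(0::real) < 2 powi k" by simp
    ultimately show "\<exists>c d. 0 < d \<and> (\<forall>y\<in>{0..1}. f (word_map w y) = c + d * y)"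
      by (intro exI[of _ "f (word_map w 0)"] exI[of _ "2 powi k"] conjI)
  qed
  \<comment> \<open>Preimages of 0 and 1 exist, and monotonicity then forces the end points to be
    fixed.\<close>
  have "0 \<in> f ` {0..1}" "1 \<in> f ` {0..1}" unfolding surj by auto
  then obtain x0 x1 where x: "x0 \<in> {0..1}" "f x0 = 0" "x1 \<in> {0..1}" "f x1 = 1"
    unfolding image_iff by metis
  have rng: "f 0 \<in> {0..1}" "f 1 \<in> {0..1}"
    using imageI[of 0 "{0..1}" f] imageI[of 1 "{0..1}" f] unfolding surj by simp_all
  show f0: "f 0 = 0"
  proof -
    have "f 0 \<le> f x0" using x(1) by (intro strict_mono_on_leD[OF mono]) auto
    then show ?thesis using x(2) rng(1) by simp
  qed
  show "f 1 = 1"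
  proof -
    have "f x1 \<le> f 1" using x(3) by (intro strict_mono_on_leD[OF mono]) auto
    then show ?thesis using x(4) rng(2) by simp
  qed
  have dy: "\<forall>w\<in>set (leaves (full_tree N)). f (word_map w 0) \<in> dyadic_rationals"
  proof (rule tiles_dyadic_values[OF tiles_leaves])
    show "f 0 \<in> dyadic_rationals"
      unfolding f0 by (simp add: dyadic_rationals_iff)
    show "\<exists>k::int. f (word_map w 1) = f (word_map w 0) + 2 powi k"
      if w: "w \<in> set (leaves (full_tree N))" for w
    proof -
      obtain k :: int where k: "\<forall>y\<in>{0..1}. f (word_map w y) = f (word_map w 0) + 2 powi k * y"
        using N[OF length_leaf_full_tree[OF w]] by blast
      show ?thesis using k[rule_format, of 1] by (intro exI[of _ k]) simp
    qed
  qed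
  \<comment> \<open>Cut the interval of \<open>w\<close> into 2^r equal parts: \<open>P w r\<close>
    says that their images have length 2^-n and ends at multiples of 2^-n. As this holds for all
    large r, one r serves all words.\<close>
  define P where "P = (\<lambda>w r. \<exists>c n. (\<forall>y\<in>{0..1}. f (word_map w y) = c + 2 ^ r / 2 ^ n * y)
    \<and> 2 ^ n * c \<in> \<int>)"
  have "\<forall>\<^sub>F r in sequentially. P w r" if w: "length w = N" for w
  proof -
    define c where "c = f (word_map w 0)"
    obtain k :: int where k: "\<forall>y\<in>{0..1}. f (word_map w y) = c + 2 powi k * y"
      using N[OF w] unfolding c_def by blast
    have "c \<in> dyadic_rationals"
      using dy w set_leaves_full_tree unfolding c_def by blast
    then obtain n0 where n0: "\<And>n. n0 \<le> n \<Longrightarrow> 2 ^ n * c \<in> \<int>"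
      unfolding dyadic_rationals_iff eventually_sequentially by blast
    have "P w r" if r: "n0 + nat \<bar>k\<bar> \<le> r" for r
    proof -
      \<comment> \<open>Then 2^r/2^n is the given factor 2^k, and a large r makes n large enough to
        clear the denominator of \<open>c\<close>.\<close>
      define n where "n = nat (int r - k)"
      have n: "n0 \<le> n" "k = int r - int n"
        using r by (auto simp: n_def)
      then have "2 powi k = (2 ^ r / 2 ^ n :: real)"
        by (simp add: power_int_diff)
      then show ?thesis
        unfolding P_def using k n0[OF n(1)] by (intro exI[of _ c] exI[of _ n]) auto
    qed
    then show ?thesis unfolding eventually_sequentially by blast
  qed
  then have "\<forall>\<^sub>F r in sequentially. \<forall>w\<in>{w. length w = N}. P w r"
    by (intro eventually_ball_finite finite_words) auto
  then obtain r where r: "\<And>w. length w = N \<Longrightarrow> P w r"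
    by (auto simp: eventually_sequentially)
  have "dyadic_map f (N + r)"
    unfolding dyadic_map_def
  proof (intro allI impI)
    fix W :: "bool list" assume W: "length W = N + r"
    define w u where "w = take N W" and "u = drop N W"
    have wu: "W = w @ u" "length w = N" "length u = r" using W by (auto simp: w_def u_def)
    obtain c n where n: "\<And>y. y \<in> {0..1} \<Longrightarrow> f (word_map w y) = c + 2 ^ r / 2 ^ n * y"
      "2 ^ n * c \<in> \<int>"
      using r[OF wu(2)] unfolding P_def by blast
    obtain i :: int where i: "2 ^ n * c = i" using n(2) by (auto elim: Ints_cases)
    obtain j :: int where j: "word_map u 0 = j / 2 ^ r" using word_map_at_integer[of u] wu by auto
    have fW: "f (word_map W y) = (of_int (i + j) + y) / 2 ^ n" if "y \<in> {0..1}" for y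
    proof -
      have "f (word_map W y) = c + 2 ^ r / 2 ^ n * word_map u y"
        unfolding wu(1) word_map_append by (rule n(1)[OF word_map_bounds[OF that]])
      also have "c = i / 2 ^ n" using i by (simp add: field_simps)
      also have "word_map u y = (j + y) / 2 ^ r"
        using word_map_affine[of u y] j wu by (simp add: add_divide_distrib)
      also have "i / 2 ^ n + 2 ^ r / 2 ^ n * ((j + y) / 2 ^ r) = i / 2 ^ n + (j + y) / 2 ^ n"
        by simp
      finally show ?thesis by (simp add: add_divide_distrib)
    qed
    have rng: "f (word_map W y) \<in> {0..1}" if "y \<in> {0..1}" for y
      using surj word_map_bounds[OF that] by blast
    \<comment> \<open>The image lies in [0,1], so \<open>i + j\<close> is the number of an interval
      of level n and hence given by a word.\<close>
    have "0 \<le> of_int (i + j) / (2::real) ^ n" "(of_int (i + j) + 1) / (2::real) ^ n \<le> 1"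
      using rng[of 0] rng[of 1] fW[of 0] fW[of 1] by auto
    then have "(0::real) \<le> of_int (i + j)" "of_int (i + j + 1) \<le> (of_int (2 ^ n) :: real)"
      by (auto simp: field_simps)
    then have "0 \<le> i + j" "i + j < 2 ^ n"
      by (simp_all only: of_int_0_le_iff of_int_le_iff)
    then obtain v where "\<And>y. word_map v y = (of_int (i + j) + y) / 2 ^ n"
      using ex_word_map by blast
    then show "\<exists>v. \<forall>y\<in>{0..1}. f (word_map W y) = word_map v y" using fW by metis
  qed
  then show "\<exists>N. dyadic_map f N" by blast
qed (use dyadic_map_in_carrier in blast)

section \<open>Tree diagrams for the elements of F\<close>

lemma leaves_not_Nil: "leaves T \<noteq> []"
  by (induction T) auto

lemma tiles_ends:
  assumes "tiles a b ws" "ws \<noteq> []"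
  shows "word_map (ws ! 0) 0 = a" "word_map (ws ! (length ws - 1)) 1 = b"
  using assms
proof (induction ws arbitrary: a)
  case (Cons w ws)
  { case 1 then show ?case by simp }
  { case 2 then show ?case using Cons.IH(2)[of "word_map w 1"] by (cases ws) auto }
qed auto

lemma represents_ends:
  assumes "represents Tp Tm f"
  shows "f 0 = 0" "f 1 = 1"
proof -
  note p = tiles_ends[OF tiles_leaves leaves_not_Nil]
  have n: "0 < length (leaves Tp)" "length (leaves Tp) = length (leaves Tm)"
    using leaves_not_Nil[of Tp] assms by (auto simp: represents_iff)
  have "f (word_map (leaves Tp ! 0) 0) = word_map (leaves Tm ! 0) 0"
    using assms n unfolding represents_iff by simp
  then show "f 0 = 0" unfolding p .
  have "f (word_map (leaves Tp ! (length (leaves Tp) - 1)) 1) = word_map (leaves Tm ! (length (leaves Tm) - 1)) 1"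
    using assms n unfolding represents_iff by simp
  then show "f 1 = 1" unfolding p .
qed

text \<open>A word as long as the longest leaf extends some leaf; the leaf is replaced and the
  remaining digits are copied.\<close>

lemma represents_dyadic_map:
  assumes "represents Tp Tm f"
  shows "\<exists>N. dyadic_map f N"
proof -
  define N where "N = Max (length ` set (leaves Tp))"
  have "\<exists>v. \<forall>y\<in>{0..1}. f (word_map w y) = word_map v y" if w: "length w = N" for w
  proof -
    have "length u \<le> length w" if "u \<in> set (leaves Tp)" for u
      unfolding w N_def using that by (intro Max_ge) auto
    then obtain k where k: "k < length (leaves Tp)" "prefix (leaves Tp ! k) w"
      using ex_leaf_prefix by blast
    then obtain u where u: "w = leaves Tp ! k @ u" by (auto elim: prefixE)
    have "f (word_map w y) = word_map (leaves Tm ! k @ u) y" if "y \<in> {0..1}" for y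
      using assms k(1) word_map_bounds[OF that, of u] by (simp add: represents_iff u word_map_append)
    then show ?thesis by blast
  qed
  then show ?thesis unfolding dyadic_map_def by blast
qed

text \<open>The full tree of level \<open>N\<close> serves as the top tree. The images of its leaf
  intervals again tile [0,1], and this tiling is the bottom tree.\<close>

theorem carrier_iff_represents:
  "f \<in> carrier thompson_F \<longleftrightarrow> f \<in> extensional {0..1} \<and> (\<exists>Tp Tm. represents Tp Tm f)"
proof (intro iffI conjI; (elim conjE exE)?)
  assume f: "f \<in> carrier thompson_F"
  then obtain N where N: "dyadic_map f N" and ends: "f 0 = 0" "f 1 = 1"
    by (auto simp: carrier_thompson_F)
  from N obtain h where h: "\<And>w y. length w = N \<Longrightarrow> y \<in> {0..1} \<Longrightarrow> f (word_map w y) = word_map (h w) y"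
    unfolding dyadic_map_def by metis
  let ?L = "leaves (full_tree N)"
  have "tiles (f 0) (f 1) (map h ?L)"
  proof (rule tiles_map[OF tiles_leaves])
    fix w assume "w \<in> set ?L"
    then have w: "length w = N" by (rule length_leaf_full_tree)
    show "word_map (h w) 0 = f (word_map w 0)" using h[OF w, of 0] by simp
    show "word_map (h w) 1 = f (word_map w 1)" using h[OF w, of 1] by simp
  qed
  then obtain Tm where Tm: "leaves Tm = map h ?L"
    using tiles_obtain_tree ends by metis
  have "represents (full_tree N) Tm f"
    unfolding represents_iff Tm using h length_leaf_full_tree[OF nth_mem] by auto
  then show "\<exists>Tp Tm. represents Tp Tm f" by blast
next
  fix Tp Tm assume "f \<in> extensional {0..1}" "represents Tp Tm f"
  then show "f \<in> carrier thompson_F"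
    unfolding carrier_thompson_F using represents_ends represents_dyadic_map by blast
qed (simp add: carrier_thompson_F)

section \<open>The group structure of F\<close>

lemma thompson_F_ends: "f \<in> carrier thompson_F \<Longrightarrow> f 0 = 0 \<and> f 1 = 1"
  by (simp add: carrier_thompson_F)

lemma thompson_F_strict_mono: "f \<in> carrier thompson_F \<Longrightarrow> strict_mono_on {0..1} f"
  unfolding carrier_thompson_F by (elim conjE exE) (simp only: dyadic_map_continuous_strict_mono)

lemma thompson_F_bij: "f \<in> carrier thompson_F \<Longrightarrow> bij_betw f {0..1} {0..1}"
  unfolding bij_betw_def carrier_thompson_F by (elim conjE exE) (simp only: dyadic_map_image)

lemma thompson_F_bounds: "f \<in> carrier thompson_F \<Longrightarrow> x \<in> {0..1} \<Longrightarrow> f x \<in> {0..1}"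
  using thompson_F_bij bij_betwE by blast

lemma thompson_F_bounds_strict:
  assumes "f \<in> carrier thompson_F" "x \<in> {0<..<1}"
  shows "f x \<in> {0<..<1}"
  using strict_mono_onD[OF thompson_F_strict_mono[OF assms(1)], of 0 x]
    strict_mono_onD[OF thompson_F_strict_mono[OF assms(1)], of x 1] thompson_F_ends[OF assms(1)] assms(2)
  by auto

lemma mult_thompson_F: "f \<otimes>\<^bsub>thompson_F\<^esub> g = compose {0..1} g f"
  by (simp add: thompson_F_def)

lemma mult_thompson_F_apply: "x \<in> {0..1} \<Longrightarrow> (f \<otimes>\<^bsub>thompson_F\<^esub> g) x = g (f x)"
  by (simp add: mult_thompson_F compose_eq)

lemma one_thompson_F: "\<one>\<^bsub>thompson_F\<^esub> = (\<lambda>x\<in>{0..1}. x)"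
  by (simp add: thompson_F_def)

text \<open>The last \<open>N\<close> digits survive the prefix replacement by \<open>f\<close>, so
  the image word is still long enough for \<open>g\<close>.\<close>

lemma dyadic_map_compose:
  assumes "dyadic_map f M" "dyadic_map g N"
  shows "dyadic_map (compose {0..1} g f) (M + N)"
  unfolding dyadic_map_def
proof (intro allI impI)
  fix W :: "bool list" assume W: "length W = M + N"
  define w u where "w = take M W" and "u = drop M W"
  have wu: "W = w @ u" "length w = M" "length u = N" using W by (auto simp: w_def u_def)
  obtain v where v: "\<And>y. y \<in> {0..1} \<Longrightarrow> f (word_map w y) = word_map v y"
    using assms(1) wu by (auto simp: dyadic_map_def)
  define p q where "p = take N (v @ u)" and "q = drop N (v @ u)"
  have pq: "v @ u = p @ q" "length p = N" using wu(3) unfolding p_def q_def by (simp_all del: take_append drop_append)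
  obtain v' where v': "\<And>y. y \<in> {0..1} \<Longrightarrow> g (word_map p y) = word_map v' y"
    using assms(2) pq by (auto simp: dyadic_map_def)
  have "compose {0..1} g f (word_map W y) = word_map (v' @ q) y" if y: "y \<in> {0..1}" for y
  proof -
    have "f (word_map W y) = word_map (v @ u) y"
      unfolding wu(1) word_map_append by (rule v[OF word_map_bounds[OF y]])
    then have "g (f (word_map W y)) = word_map (v' @ q) y"
      unfolding pq(1) word_map_append by (simp add: v'[OF word_map_bounds[OF y]])
    then show ?thesis using word_map_bounds[OF y] by (simp add: compose_eq)
  qed
  then show "\<exists>v. \<forall>y\<in>{0..1}. compose {0..1} g f (word_map W y) = word_map v y" by blast
qed

text \<open>Exchanging the two trees represents the inverse map.\<close>

lemma thompson_F_inverse: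
  assumes "f \<in> carrier thompson_F"
  shows "\<exists>g\<in>carrier thompson_F. g \<otimes>\<^bsub>thompson_F\<^esub> f = \<one>\<^bsub>thompson_F\<^esub>"
proof -
  define g where "g = restrict (inv_into {0..1} f) {0..1}"
  obtain Tp Tm where T: "represents Tp Tm f"
    using assms carrier_iff_represents by blast
  have bij: "inj_on f {0..1}" "f ` {0..1} = {0..1}"
    using thompson_F_bij[OF assms] by (auto simp: bij_betw_def)
  have "g (word_map (leaves Tm ! k) y) = word_map (leaves Tp ! k) y"
    if "k < length (leaves Tm)" "y \<in> {0..1}" for k y
  proof -
    have "f (word_map (leaves Tp ! k) y) = word_map (leaves Tm ! k) y"
      using T that by (simp add: represents_iff)
    then have "inv_into {0..1} f (word_map (leaves Tm ! k) y) = word_map (leaves Tp ! k) y"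
      by (intro inv_into_f_eq[OF bij(1)] word_map_bounds[OF that(2)])
    then show ?thesis
      unfolding g_def using word_map_bounds[OF that(2)] by simp
  qed
  then have "represents Tm Tp g"
    using T by (simp add: represents_iff)
  then have "g \<in> carrier thompson_F"
    by (auto simp: carrier_iff_represents g_def)
  moreover have "g \<otimes>\<^bsub>thompson_F\<^esub> f = \<one>\<^bsub>thompson_F\<^esub>"
    unfolding mult_thompson_F one_thompson_F compose_def g_def
    using f_inv_into_f[of _ f "{0..1}"] bij(2) by (intro restrict_ext) simp
  ultimately show ?thesis by blast
qed

lemma group_thompson_F: "group thompson_F"
proof (rule groupI)
  fix f g assume fg: "f \<in> carrier thompson_F" "g \<in> carrier thompson_F"
  then obtain M N where "dyadic_map f M" "dyadic_map g N"
    using carrier_thompson_F by blast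
  from dyadic_map_compose[OF this] fg show "f \<otimes>\<^bsub>thompson_F\<^esub> g \<in> carrier thompson_F"
    unfolding mult_thompson_F carrier_thompson_F by (auto simp: compose_def)
next
  have "dyadic_map (\<lambda>x\<in>{0..1}. x) 0"
    unfolding dyadic_map_def by (auto intro: exI[of _ "[]"])
  then show "\<one>\<^bsub>thompson_F\<^esub> \<in> carrier thompson_F"
    unfolding one_thompson_F carrier_thompson_F by auto
next
  fix f g h assume "f \<in> carrier thompson_F"
  then have "f \<in> {0..1} \<rightarrow> {0..1}"
    using thompson_F_bounds by blast
  from compose_assoc[OF this] show "f \<otimes>\<^bsub>thompson_F\<^esub> g \<otimes>\<^bsub>thompson_F\<^esub> h = f \<otimes>\<^bsub>thompson_F\<^esub> (g \<otimes>\<^bsub>thompson_F\<^esub> h)"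
    unfolding mult_thompson_F .
next
  fix f assume "f \<in> carrier thompson_F"
  then have "f \<in> extensional {0..1}" by (simp add: carrier_thompson_F)
  then show "\<one>\<^bsub>thompson_F\<^esub> \<otimes>\<^bsub>thompson_F\<^esub> f = f"
    unfolding mult_thompson_F one_thompson_F by (auto simp: compose_def intro!: extensionalityI)
qed (rule thompson_F_inverse)

interpretation F: group thompson_F
  by (rule group_thompson_F)


section \<open>Slopes and their parity cocycle\<close>

lemma has_slope_mult:
  assumes "f \<in> carrier thompson_F" "x \<in> {0..1}" "has_slope f x k" "has_slope g (f x) l"
  shows "has_slope (f \<otimes>\<^bsub>thompson_F\<^esub> g) x (k + l)"
proof -
  have "f ` {0..1} = {0..1}"
    using thompson_F_bij[OF assms(1)] by (simp add: bij_betw_def)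
  then have "(g has_real_derivative 2 powi l) (at (f x) within f ` {0..1})"
    using assms(4) by (simp add: has_slope_def)
  from DERIV_image_chain[OF this assms(3)[unfolded has_slope_def]]
  have "(g \<circ> f has_real_derivative 2 powi (k + l)) (at x within {0..1})"
    by (simp add: power_int_add mult.commute)
  then show ?thesis
    unfolding has_slope_def
    by (rule has_field_derivative_transform_within[OF _ zero_less_one assms(2)])
      (simp add: mult_thompson_F_apply)
qed

lemma has_slope_one: "x \<in> {0..1} \<Longrightarrow> has_slope \<one>\<^bsub>thompson_F\<^esub> x 0"
  by (rule has_slopeI[where d = 1 and c = 0]) (auto simp: one_thompson_F)

text \<open>Being linear near the fixed point 0, \<open>f\<close> keeps small points small. The
  bounds by 1/2 make both half indicators in \<open>twist\<close> vanish near 0.\<close>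

lemma slope_near_0:
  assumes "f \<in> carrier thompson_F"
  shows "\<exists>k e. 0 < e \<and> e \<le> 1/2 \<and> (\<forall>x\<in>{0..<e}. has_slope f x k \<and> f x < 1/2)"
proof -
  obtain N where N: "dyadic_map f N" and f0: "f 0 = 0"
    using assms by (auto simp: carrier_thompson_F)
  obtain v where v: "\<And>y. y \<in> {0..1} \<Longrightarrow> f (word_map (replicate N False) y) = word_map v y"
    using N unfolding dyadic_map_def by (metis length_replicate)
  obtain c k where ck: "\<And>x. x \<in> {0..1 / 2 ^ N} \<Longrightarrow> f x = c + 2 powi k * x"
    using word_piece_affine[OF v] by (auto simp: word_map_replicate_False)
  have "c = 0" using ck[of 0] f0 by simp
  have k: "(0::real) < 2 powi k" by simp
  \<comment> \<open>The three bounds keep \<open>x\<close> in the first interval of level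
    \<open>N\<close>, keep \<open>x\<close> below 1/2, and keep 2^k x below 1/2.\<close>
  define e :: real where "e = min (1 / 2 ^ N) (min (1/2) (1 / (2 * 2 powi k)))"
  have e: "0 < e" "e \<le> 1/2" "e \<le> 1 / 2 ^ N" "e \<le> 1 / (2 * 2 powi k)"
    unfolding e_def by (simp, linarith+)
  have "has_slope f x k \<and> f x < 1/2" if x: "x \<in> {0..<e}" for x
  proof
    show "has_slope f x k"
    proof (rule has_slopeI[where d = "e - x" and c = c])
      fix t assume "t \<in> {0..1}" "\<bar>t - x\<bar> < e - x"
      then have "t \<in> {0..1 / 2 ^ N}" using e(3) unfolding atLeastAtMost_iff by linarith
      then show "f t = c + 2 powi k * t" by (rule ck)
    qed (use x e(2) in auto)
    have "x \<in> {0..1 / 2 ^ N}" using x e(3) unfolding atLeastAtMost_iff atLeastLessThan_iff by linarith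
    from ck[OF this] have "f x = 2 powi k * x" using \<open>c = 0\<close> by simp
    also have "\<dots> < 2 powi k * (1 / (2 * 2 powi k))"
      using x e(4) by (intro mult_strict_left_mono[OF _ k]) auto
    also have "\<dots> = 1/2" using k by simp
    finally show "f x < 1/2" .
  qed
  then show ?thesis using e(1,2) by blast
qed

lemma slope_near_1:
  assumes "f \<in> carrier thompson_F"
  shows "\<exists>k e. 0 < e \<and> e \<le> 1/2 \<and> (\<forall>x\<in>{1 - e<..1}. has_slope f x k \<and> 1/2 < f x)"
proof -
  obtain N where N: "dyadic_map f N" and f1: "f 1 = 1"
    using assms by (auto simp: carrier_thompson_F)
  obtain v where v: "\<And>y. y \<in> {0..1} \<Longrightarrow> f (word_map (replicate N True) y) = word_map v y"
    using N unfolding dyadic_map_def by (metis length_replicate)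
  obtain c k where ck: "\<And>x. x \<in> {1 - 1 / 2 ^ N..1} \<Longrightarrow> f x = c + 2 powi k * x"
    using word_piece_affine[OF v] by (auto simp: word_map_replicate_True)
  have c: "c = 1 - 2 powi k" using ck[of 1] f1 by simp
  have k: "(0::real) < 2 powi k" by simp
  define e :: real where "e = min (1 / 2 ^ N) (min (1/2) (1 / (2 * 2 powi k)))"
  have e: "0 < e" "e \<le> 1/2" "e \<le> 1 / 2 ^ N" "e \<le> 1 / (2 * 2 powi k)"
    unfolding e_def by (simp, linarith+)
  have "has_slope f x k \<and> 1/2 < f x" if x: "x \<in> {1 - e<..1}" for x
  proof
    show "has_slope f x k"
    proof (rule has_slopeI[where d = "x - (1 - e)" and c = c])
      fix t assume "t \<in> {0..1}" "\<bar>t - x\<bar> < x - (1 - e)"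
      then have "t \<in> {1 - 1 / 2 ^ N..1}" using e(3) unfolding atLeastAtMost_iff by linarith
      then show "f t = c + 2 powi k * t" by (rule ck)
    qed (use x e(2) in auto)
    have "x \<in> {1 - 1 / 2 ^ N..1}" using x e(3) unfolding atLeastAtMost_iff greaterThanAtMost_iff by linarith
    from ck[OF this] have "f x = 1 - 2 powi k * (1 - x)" using c by (simp add: algebra_simps)
    moreover have "2 powi k * (1 - x) < 2 powi k * (1 / (2 * 2 powi k))"
      using x e(4) by (intro mult_strict_left_mono[OF _ k]) auto
    moreover have "2 powi k * (1 / (2 * 2 powi k)) = (1/2 :: real)" using k by simp
    ultimately show "1/2 < f x" by linarith
  qed
  then show ?thesis using e(1,2) by blast
qed

lemma K_subgroup_iff:
  "f \<in> K_subgroup a b \<longleftrightarrow> f \<in> carrier thompson_F \<and>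
    (\<exists>k. has_slope f 0 k \<and> int a dvd k) \<and> (\<exists>k. has_slope f 1 k \<and> int b dvd k)"
proof -
  have log_powi: "log 2 (2 powi k) = k" for k :: int
    by (simp flip: powr_real_of_int')
  \<comment> \<open>Derivatives at a point of [0,1] are unique, so any \<open>D\<close> here is 2^k
    and its logarithm is \<open>k\<close>.\<close>
  have key: "(\<exists>D (i::int). (f has_real_derivative D) (at x within {0..1}) \<and> log 2 D = of_int (int a * i))
      \<longleftrightarrow> (\<exists>k. has_slope f x k \<and> int a dvd k)" if "x \<in> {0..1}" "has_slope f x k" for x k a
  proof
    assume "\<exists>D (i::int). (f has_real_derivative D) (at x within {0..1}) \<and> log 2 D = of_int (int a * i)"
    then obtain D and i :: int where D: "(f has_real_derivative D) (at x within {0..1})"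
      "log 2 D = of_int (int a * i)" by blast
    have "D = 2 powi k"
      using unit_derivative_unique[OF D(1) that(2)[unfolded has_slope_def] that(1)] .
    then have "k = int a * i" using D(2) log_powi by (simp only: of_int_eq_iff)
    then show "\<exists>k. has_slope f x k \<and> int a dvd k" using that(2) by (metis dvd_triv_left)
  next
    assume "\<exists>k. has_slope f x k \<and> int a dvd k"
    then obtain i where "has_slope f x (int a * i)" by (auto elim: dvdE)
    then show "\<exists>D (i::int). (f has_real_derivative D) (at x within {0..1}) \<and> log 2 D = of_int (int a * i)"
      unfolding has_slope_def using log_powi by blast
  qed
  show ?thesis
  proof (cases "f \<in> carrier thompson_F")
    case True
    obtain k e where "0 < e" "\<forall>x\<in>{0..<e}. has_slope f x k" using slope_near_0[OF True] by blast
    then have k: "has_slope f 0 k" by simp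
    obtain l e where "0 < e" "\<forall>x\<in>{1 - e<..1}. has_slope f x l" using slope_near_1[OF True] by blast
    then have l: "has_slope f 1 l" by simp
    show ?thesis unfolding K_subgroup_def using True key[OF _ k] key[OF _ l] by simp
  qed (simp add: K_subgroup_def)
qed

text \<open>By the chain rule at a fixed point, the exponents of \<open>f\<close> and of its inverse
  add up to 0.\<close>

lemma dvd_slope_inv:
  assumes "f \<in> carrier thompson_F" "x \<in> {0, 1}" "has_slope f x k" "int a dvd k"
  shows "\<exists>l. has_slope (inv\<^bsub>thompson_F\<^esub> f) x l \<and> int a dvd l"
proof -
  let ?g = "inv\<^bsub>thompson_F\<^esub> f"
  have g: "?g \<in> carrier thompson_F" using assms(1) by simp
  have x: "x \<in> {0..1}" "?g x = x" using assms(2) thompson_F_ends[OF g] by auto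
  obtain l where l: "has_slope ?g x l"
  proof (cases "x = 0")
    case True
    then show ?thesis using slope_near_0[OF g] that by fastforce
  next
    case False
    then show ?thesis using slope_near_1[OF g] assms(2) that by fastforce
  qed
  have "has_slope (?g \<otimes>\<^bsub>thompson_F\<^esub> f) x (l + k)"
    using has_slope_mult[OF g x(1) l] assms(3) x(2) by simp
  then have "l + k = 0"
    using has_slope_unique[OF _ has_slope_one[OF x(1)] x(1)] assms(1) by simp
  then have "int a dvd l" using assms(4) by (simp add: add_eq_0_iff)
  then show ?thesis using l by blast
qed

lemma subgroup_K_subgroup: "subgroup (K_subgroup a b) thompson_F"
proof (rule F.subgroupI)
  show "K_subgroup a b \<subseteq> carrier thompson_F" by (auto simp: K_subgroup_def)
  have "\<one>\<^bsub>thompson_F\<^esub> \<in> K_subgroup a b"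
    using has_slope_one[of 0] has_slope_one[of 1] by (auto simp: K_subgroup_iff intro!: exI[of _ 0])
  then show "K_subgroup a b \<noteq> {}" by blast
  show "inv\<^bsub>thompson_F\<^esub> f \<in> K_subgroup a b" if "f \<in> K_subgroup a b" for f
    using that dvd_slope_inv[of f 0] dvd_slope_inv[of f 1] unfolding K_subgroup_iff by auto
  show "f \<otimes>\<^bsub>thompson_F\<^esub> g \<in> K_subgroup a b" if fg: "f \<in> K_subgroup a b" "g \<in> K_subgroup a b" for f g
  proof -
    have f: "f \<in> carrier thompson_F" and g: "g \<in> carrier thompson_F"
      using fg by (auto simp: K_subgroup_iff)
    obtain i j k l where "has_slope f 0 i" "has_slope g 0 j" "int a dvd i" "int a dvd j"
      "has_slope f 1 k" "has_slope g 1 l" "int b dvd k" "int b dvd l"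
      using fg unfolding K_subgroup_iff by blast
    then have "has_slope (f \<otimes>\<^bsub>thompson_F\<^esub> g) 0 (i + j)" "has_slope (f \<otimes>\<^bsub>thompson_F\<^esub> g) 1 (k + l)"
      "int a dvd i + j" "int b dvd k + l"
      using has_slope_mult[OF f, of 0] has_slope_mult[OF f, of 1] thompson_F_ends[OF f] by auto
    then show ?thesis using f g unfolding K_subgroup_iff by blast
  qed
qed

text \<open>The filter of properties that hold on (0,1) up to finitely many points; it discards
  breakpoints and ends of leaf intervals.\<close>

definition generic :: "real filter" where
  "generic = inf cofinite (principal {0<..<1})"

lemma eventually_generic: "eventually P generic \<longleftrightarrow> finite {x \<in> {0<..<1}. \<not> P x}"
  by (simp add: generic_def eventually_inf_principal eventually_cofinite conj_commute)

lemma eventually_generic_ex: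
  assumes "eventually P generic" "0 \<le> a" "a < b" "b \<le> 1"
  shows "\<exists>x\<in>{a<..<b}. P x"
proof (rule ccontr)
  assume "\<not> ?thesis"
  then have "{a<..<b} \<subseteq> {x \<in> {0<..<1}. \<not> P x}" using assms by auto
  then show False
    using assms(1,3) infinite_Ioo finite_subset unfolding eventually_generic by blast
qed

lemma eventually_generic_unit: "\<forall>\<^sub>F x in generic. x \<in> {0<..<1}"
proof -
  have "{x \<in> {0<..<1}. x \<notin> {0<..<1}} = ({} :: real set)" by blast
  then show ?thesis unfolding eventually_generic by (simp only: finite.emptyI)
qed

text \<open>As \<open>f\<close> is a bijection, the preimage of the finite exceptional set is
  finite.\<close>

lemma eventually_generic_compose:
  assumes "f \<in> carrier thompson_F" "eventually P generic"
  shows "\<forall>\<^sub>F x in generic. P (f x)"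
proof -
  have "finite (f -` {x \<in> {0<..<1}. \<not> P x} \<inter> {0..1})"
    using assms(2) thompson_F_bij[OF assms(1)]
    by (intro finite_vimage_IntI) (auto simp: eventually_generic bij_betw_def)
  moreover have "{x \<in> {0<..<1}. \<not> P (f x)} \<subseteq> f -` {x \<in> {0<..<1}. \<not> P x} \<inter> {0..1}"
    using thompson_F_bounds_strict[OF assms(1)] by fastforce
  ultimately show ?thesis
    unfolding eventually_generic by (rule finite_subset[rotated])
qed

lemma eventually_has_slope:
  assumes "f \<in> carrier thompson_F"
  shows "\<forall>\<^sub>F x in generic. \<exists>k. has_slope f x k"
proof -
  have "\<exists>S. finite S \<and> S \<subseteq> dyadic_rationals \<and> (\<forall>x\<in>{0..1} - S. \<exists>k. has_slope f x k)"
    using assms by (simp add: thompson_F_def has_slope_def)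
  then obtain S where S: "finite S" "\<And>x. x \<in> {0..1} - S \<Longrightarrow> \<exists>k. has_slope f x k" by meson
  have "{x \<in> {0<..<1}. \<nexists>k. has_slope f x k} \<subseteq> S"
  proof
    fix x assume "x \<in> {x \<in> {0<..<1}. \<nexists>k. has_slope f x k}"
    then show "x \<in> S" using S(2)[of x] by fastforce
  qed
  then show ?thesis
    unfolding eventually_generic using S(1) finite_subset by blast
qed

text \<open>The default value is false where no power-of-2 slope exists. For an element of F this
  concerns finitely many points of (0,1).\<close>

definition twist :: "(real \<Rightarrow> real) \<Rightarrow> real \<Rightarrow> bool" where
  "twist f x \<longleftrightarrow> (\<exists>k. has_slope f x k \<and> even (k + of_bool (1/2 \<le> x) + of_bool (1/2 \<le> f x)))"

lemma twist_iff:
  assumes "has_slope f x k" "x \<in> {0..1}"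
  shows "twist f x \<longleftrightarrow> even (k + of_bool (1/2 \<le> x) + of_bool (1/2 \<le> f x))"
  using assms has_slope_unique unfolding twist_def by blast

text \<open>Slope exponents add, and the indicator of f x \<ge> 1/2 occurs on both sides of the
  composition, so it cancels mod 2.\<close>

lemma twist_mult:
  assumes "f \<in> carrier thompson_F" "g \<in> carrier thompson_F"
  shows "\<forall>\<^sub>F x in generic. twist (f \<otimes>\<^bsub>thompson_F\<^esub> g) x \<longleftrightarrow> (twist f x \<longleftrightarrow> twist g (f x))"
  using eventually_generic_unit eventually_has_slope[OF assms(1)]
    eventually_generic_compose[OF assms(1) eventually_has_slope[OF assms(2)]]
proof eventually_elim
  case (elim x)
  then obtain k l where kl: "has_slope f x k" "has_slope g (f x) l" by blast
  have x: "x \<in> {0..1}" using elim(1) by simp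
  show ?case
    unfolding twist_iff[OF has_slope_mult[OF assms(1) x kl] x] twist_iff[OF kl(1) x]
      twist_iff[OF kl(2) thompson_F_bounds[OF assms(1) x]] mult_thompson_F_apply[OF x]
    by (simp only: even_add) blast
qed

lemma twist_one: "x \<in> {0..1} \<Longrightarrow> twist \<one>\<^bsub>thompson_F\<^esub> x"
  by (subst twist_iff[OF has_slope_one]) (simp_all add: one_thompson_F)

text \<open>Near 0 both half indicators are 0, near 1 both are 1. In either case
  \<open>twist\<close> is the evenness of the slope exponent at that end.\<close>

lemma twist_const_slope:
  assumes "f \<in> carrier thompson_F" "\<forall>\<^sub>F x in generic. twist f x = s"
  shows "has_slope f 0 k \<Longrightarrow> even k \<longleftrightarrow> s" "has_slope f 1 k \<Longrightarrow> even k \<longleftrightarrow> s"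
proof -
  assume k: "has_slope f 0 k"
  obtain l e where e: "0 < e" "e \<le> 1/2" "\<And>x. x \<in> {0..<e} \<Longrightarrow> has_slope f x l \<and> f x < 1/2"
    using slope_near_0[OF assms(1)] by blast
  have "l = k" using e(1) e(3)[of 0] k has_slope_unique[of f 0] by simp
  obtain x where x: "x \<in> {0<..<e}" "twist f x = s"
    using eventually_generic_ex[OF assms(2), of 0 e] e(1,2) by auto
  then show "even k \<longleftrightarrow> s"
    using e(2) e(3)[of x] twist_iff[of f x l] \<open>l = k\<close> by auto
next
  assume k: "has_slope f 1 k"
  obtain l e where e: "0 < e" "e \<le> 1/2" "\<And>x. x \<in> {1 - e<..1} \<Longrightarrow> has_slope f x l \<and> 1/2 < f x"
    using slope_near_1[OF assms(1)] by blast
  have "l = k" using e(1) e(3)[of 1] k has_slope_unique[of f 1] by simp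
  obtain x where x: "x \<in> {1 - e<..<1}" "twist f x = s"
    using eventually_generic_ex[OF assms(2), of "1 - e" 1] e(1,2) by auto
  then show "even k \<longleftrightarrow> s"
    using e(2) e(3)[of x] twist_iff[of f x l] \<open>l = k\<close> by auto
qed

section \<open>Colorings of tree diagrams\<close>

definition leaf_indices :: "btree \<Rightarrow> bool list \<Rightarrow> nat set" where
  "leaf_indices T v = {k. k < length (leaves T) \<and> prefix v (leaves T ! k)}"

lemma leaf_indices_root: "leaf_indices T [] = {0..<length (leaves T)}"
  by (auto simp: leaf_indices_def)

lemma leaf_indices_left: "leaf_indices (Caret l r) (False # v) = leaf_indices l v"
proof (intro equalityI subsetI)
  fix k assume k: "k \<in> leaf_indices (Caret l r) (False # v)"
  have "k < length (leaves l)"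
  proof (rule ccontr)
    assume "\<not> k < length (leaves l)"
    then show False using k by (auto simp: leaf_indices_def nth_append)
  qed
  then show "k \<in> leaf_indices l v"
    using k by (auto simp: leaf_indices_def nth_append)
qed (auto simp: leaf_indices_def nth_append)

lemma leaf_indices_right:
  "leaf_indices (Caret l r) (True # v) = (+) (length (leaves l)) ` leaf_indices r v"
proof (intro equalityI subsetI)
  fix k assume "k \<in> leaf_indices (Caret l r) (True # v)"
  then have "k - length (leaves l) \<in> leaf_indices r v" "length (leaves l) \<le> k"
    by (auto simp: leaf_indices_def nth_append split: if_splits)
  then show "k \<in> (+) (length (leaves l)) ` leaf_indices r v"
    by (metis imageI le_add_diff_inverse)
qed (auto simp: leaf_indices_def nth_append)

lemma leaf_indices_nonempty: "v \<in> vertices T \<Longrightarrow> leaf_indices T v \<noteq> {}"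
proof (induction T arbitrary: v)
  case (Caret l r)
  then show ?case
    using leaves_not_Nil[of l] by (auto simp: leaf_indices_root leaf_indices_left leaf_indices_right)
qed (simp add: leaf_indices_root)

text \<open>The differing-colors condition for the edges above all vertices of a tree, with the regions
  numbered from the left end of the tree and the root given an edge as well.\<close>

primrec proper :: "btree \<Rightarrow> (nat \<Rightarrow> 3) \<Rightarrow> bool" where
  "proper Tip c \<longleftrightarrow> c 0 \<noteq> c 1"
| "proper (Caret l r) c \<longleftrightarrow> c 0 \<noteq> c (length (leaves l) + length (leaves r)) \<and> proper l c \<and>
    proper r (\<lambda>i. c (length (leaves l) + i))"

text \<open>Carries the conditions of a right subtree over to its own numbering of regions. An empty
  set would equal {p..<q} whenever p \<ge> q, so the bounds would not be determined.\<close>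

lemma shifted_interval:
  fixes n :: nat
  assumes "A \<noteq> {}"
  shows "(\<forall>p q. (+) n ` A = {p..<q} \<longrightarrow> P p q) \<longleftrightarrow> (\<forall>p q. A = {p..<q} \<longrightarrow> P (n + p) (n + q))"
proof (intro iffI allI impI)
  fix p q assume H: "\<forall>p q. A = {p..<q} \<longrightarrow> P (n + p) (n + q)" and A: "(+) n ` A = {p..<q}"
  have "p < q" using A assms by auto
  then have "p \<in> (+) n ` A" unfolding A by simp
  then have np: "n \<le> p" by auto
  then have "(+) n ` A = (+) n ` {p - n..<q - n}"
    using \<open>p < q\<close> unfolding A by simp
  then have "A = {p - n..<q - n}"
    by (rule inj_image_eq_iff[OF inj_on_add, THEN iffD1])
  then have "P (n + (p - n)) (n + (q - n))" using H by blast
  then show "P p q" using np \<open>p < q\<close> by simp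
next
  fix p q assume "\<forall>p q. (+) n ` A = {p..<q} \<longrightarrow> P p q" "A = {p..<q}"
  then show "P (n + p) (n + q)"
    by (simp add: add.commute)
qed

lemma interval_eq: "(\<forall>p q. {0..<n} = {p..<q} \<longrightarrow> P p q) \<longleftrightarrow> P 0 n" if "0 < n" for n :: nat
  using that by (metis atLeastLessThan_eq_iff atLeastLessThan_empty_iff2)

lemma proper_iff:
  "proper T c \<longleftrightarrow> (\<forall>v\<in>vertices T. \<forall>p q. leaf_indices T v = {p..<q} \<longrightarrow> c p \<noteq> c q)"
proof (induction T arbitrary: c)
  case Tip
  show ?case
    using interval_eq[of 1 "\<lambda>p q. c p \<noteq> c q"] by (simp add: leaf_indices_root)
next
  case (Caret l r)
  have "0 < length (leaves l) + length (leaves r)" using leaves_not_Nil[of l] by simp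
  then show ?case
    by (simp add: ball_Un leaf_indices_root leaf_indices_left leaf_indices_right interval_eq
        shifted_interval[OF leaf_indices_nonempty] Caret.IH)
qed

text \<open>The root has no edge, so only the two subtrees impose conditions, each including the
  edge above its own root.\<close>

lemma edges_proper:
  "(\<forall>p q. edge_separates (Caret l r) p q \<longrightarrow> c p \<noteq> c q) \<longleftrightarrow>
    proper l c \<and> proper r (\<lambda>i. c (length (leaves l) + i))"
proof -
  have "(\<forall>p q. edge_separates (Caret l r) p q \<longrightarrow> c p \<noteq> c q) \<longleftrightarrow>
      (\<forall>v\<in>vertices (Caret l r). v \<noteq> [] \<longrightarrow> (\<forall>p q. leaf_indices (Caret l r) v = {p..<q} \<longrightarrow> c p \<noteq> c q))"
    unfolding edge_separates_def leaf_indices_def by blast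
  also have "\<dots> \<longleftrightarrow> proper l c \<and> proper r (\<lambda>i. c (length (leaves l) + i))"
    by (simp add: ball_Un leaf_indices_left leaf_indices_right
        shifted_interval[OF leaf_indices_nonempty] proper_iff)
  finally show ?thesis .
qed

lemma nonzero_mod_3: "x = 1 \<or> x = - 1" if "x \<noteq> 0" for x :: 3
  using exhaust_3[of x] that by auto

text \<open>Two nonzero residues mod 3 with nonzero sum are equal, and x + x = -x.\<close>

lemma split_mod_3: "x = - (x + y) \<and> y = - (x + y)" if "x \<noteq> 0" "y \<noteq> 0" "x + y \<noteq> 0" for x y :: 3
  using nonzero_mod_3[OF that(1)] nonzero_mod_3[OF that(2)] that(3) by auto

lemma proper_root: "proper T c \<Longrightarrow> c 0 \<noteq> c (length (leaves T))"
  by (cases T) auto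

text \<open>Every caret passes the negative of its color difference to both children, so a leaf gets
  one sign change per level.\<close>

lemma proper_leaf_differences:
  assumes "proper T c" "k < length (leaves T)"
  shows "c (Suc k) - c k = (- 1) ^ length (leaves T ! k) * (c (length (leaves T)) - c 0)"
  using assms
proof (induction T arbitrary: c k)
  case (Caret l r)
  let ?m = "length (leaves l)" and ?n = "length (leaves r)"
  define x y where "x = c ?m - c 0" and "y = c (?m + ?n) - c ?m"
  have nz: "x \<noteq> 0" "y \<noteq> 0" "x + y \<noteq> 0"
    using proper_root[of l c] proper_root[of r "\<lambda>i. c (?m + i)"] Caret.prems(1)
    by (auto simp: x_def y_def)
  have xy: "c (length (leaves (Caret l r))) - c 0 = x + y"
    by (simp add: x_def y_def)
  show ?case
  proof (cases "k < ?m")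
    case True
    have "c (Suc k) - c k = (- 1) ^ length (leaves l ! k) * x"
      using Caret.IH(1)[of c k] Caret.prems(1) True by (simp add: x_def)
    also have "x = - (x + y)" using split_mod_3[OF nz] by blast
    finally show ?thesis
      using True unfolding xy by (simp add: nth_append del: minus_add_distrib)
  next
    case False
    then obtain j where j: "k = ?m + j" "j < ?n"
      using Caret.prems(2) by (metis add_diff_inverse_nat leaves.simps(2) length_append length_map nat_add_left_cancel_less)
    have "c (Suc k) - c k = (- 1) ^ length (leaves r ! j) * y"
      using Caret.IH(2)[of "\<lambda>i. c (?m + i)" j] Caret.prems(1) j by (simp add: y_def)
    also have "y = - (x + y)" using split_mod_3[OF nz] by blast
    finally show ?thesis
      using j unfolding xy by (simp add: nth_append del: minus_add_distrib)
  qed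
qed auto

text \<open>Conversely the differences across the two subtrees come out as -e each, and -e - e = e
  mod 3 is the nonzero difference across the root.\<close>

lemma proper_of_leaf_differences:
  assumes "\<And>k. k < length (leaves T) \<Longrightarrow> c (Suc k) - c k = (- 1) ^ length (leaves T ! k) * e" "e \<noteq> 0"
  shows "proper T c \<and> c (length (leaves T)) - c 0 = e"
  using assms
proof (induction T arbitrary: c e)
  case Tip
  then show ?case using Tip(1)[of 0] by auto
next
  case (Caret l r)
  let ?m = "length (leaves l)" and ?n = "length (leaves r)"
  have e: "- e \<noteq> 0" "- e - e = e"
    using Caret.prems(2) nonzero_mod_3[OF Caret.prems(2)] by auto
  have L: "proper l c \<and> c ?m - c 0 = - e"
  proof (rule Caret.IH(1)[OF _ e(1)])
    fix k assume "k < ?m"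
    then show "c (Suc k) - c k = (- 1) ^ length (leaves l ! k) * - e"
      using Caret.prems(1)[of k] by (simp add: nth_append)
  qed
  have R: "proper r (\<lambda>i. c (?m + i)) \<and> c (?m + ?n) - c (?m + 0) = - e"
  proof (rule Caret.IH(2)[OF _ e(1)])
    fix k assume "k < ?n"
    then show "c (?m + Suc k) - c (?m + k) = (- 1) ^ length (leaves r ! k) * - e"
      using Caret.prems(1)[of "?m + k"] by (simp add: nth_append)
  qed
  have "c (?m + ?n) - c 0 = (c (?m + ?n) - c (?m + 0)) + (c ?m - c 0)" by simp
  also have "\<dots> = e" using L R e(2) by simp
  finally show ?case using L R Caret.prems(2) by auto
qed

text \<open>Used only for nonempty words, since \<open>hd []\<close> is unspecified.\<close>

definition leaf_parity :: "bool list \<Rightarrow> nat" where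
  "leaf_parity w = length w + of_bool (hd w)"

text \<open>Both ends of the tree border the outer region, so the differences across the two
  children of the root are opposite instead of equal. The first digit in \<open>leaf_parity\<close>
  corrects the sign in the right half. For \<open>Tip\<close> there is no edge, while the right-hand
  side would force two colors for the outer region.\<close>

lemma tree_coloring_iff:
  fixes c :: "nat \<Rightarrow> 3"
  assumes "T \<noteq> Tip"
  shows "(\<forall>p q. edge_separates T p q \<longrightarrow> c p \<noteq> c q) \<and> c 0 = c (length (leaves T)) \<longleftrightarrow>
    (\<exists>e. e \<noteq> 0 \<and> (\<forall>k < length (leaves T). c (Suc k) - c k = (- 1) ^ leaf_parity (leaves T ! k) * e))"
proof -
  obtain l r where T: "T = Caret l r" using assms by (cases T) auto
  let ?m = "length (leaves l)" and ?n = "length (leaves r)"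
  show ?thesis
  proof (intro iffI)
    assume "(\<forall>p q. edge_separates T p q \<longrightarrow> c p \<noteq> c q) \<and> c 0 = c (length (leaves T))"
    then have H: "proper l c" "proper r (\<lambda>i. c (?m + i))" "c 0 = c (?m + ?n)"
      unfolding T edges_proper by auto
    \<comment> \<open>The sign is such that the left child of the root has difference -e and the
      right child e.\<close>
    define e where "e = c 0 - c ?m"
    have "e \<noteq> 0" using proper_root[OF H(1)] by (simp add: e_def)
    moreover have "c (Suc k) - c k = (- 1) ^ leaf_parity (leaves T ! k) * e" if k: "k < length (leaves T)" for k
    proof (cases "k < ?m")
      case True
      have "c ?m - c 0 = - e" by (simp add: e_def)
      then show ?thesis
        using proper_leaf_differences[OF H(1) True] True
        by (simp add: T nth_append leaf_parity_def)
    next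
      case False
      then obtain j where j: "k = ?m + j" "j < ?n"
        using k unfolding T by (metis add_diff_inverse_nat leaves.simps(2) length_append length_map nat_add_left_cancel_less)
      have "c (?m + ?n) - c ?m = e" by (simp add: e_def H(3))
      then show ?thesis
        using proper_leaf_differences[OF H(2) j(2)] j
        by (simp add: T nth_append leaf_parity_def)
    qed
    ultimately show "\<exists>e. e \<noteq> 0 \<and> (\<forall>k < length (leaves T). c (Suc k) - c k = (- 1) ^ leaf_parity (leaves T ! k) * e)"
      by blast
  next
    assume "\<exists>e. e \<noteq> 0 \<and> (\<forall>k < length (leaves T). c (Suc k) - c k = (- 1) ^ leaf_parity (leaves T ! k) * e)"
    then obtain e where e: "e \<noteq> 0"
      and d: "\<And>k. k < length (leaves T) \<Longrightarrow> c (Suc k) - c k = (- 1) ^ leaf_parity (leaves T ! k) * e"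
      by blast
    have L: "proper l c \<and> c ?m - c 0 = - e"
    proof (rule proper_of_leaf_differences)
      fix k assume "k < ?m"
      then show "c (Suc k) - c k = (- 1) ^ length (leaves l ! k) * - e"
        using d[of k] by (simp add: T nth_append leaf_parity_def)
    qed (use e in simp)
    have R: "proper r (\<lambda>i. c (?m + i)) \<and> c (?m + ?n) - c (?m + 0) = e"
    proof (rule proper_of_leaf_differences)
      fix k assume "k < ?n"
      then show "c (?m + Suc k) - c (?m + k) = (- 1) ^ length (leaves r ! k) * e"
        using d[of "?m + k"] by (simp add: T nth_append leaf_parity_def)
    qed (use e in simp)
    have "c (?m + ?n) - c 0 = (c (?m + ?n) - c (?m + 0)) + (c ?m - c 0)" by simp
    also have "\<dots> = 0" using L R by simp
    finally show "(\<forall>p q. edge_separates T p q \<longrightarrow> c p \<noteq> c q) \<and> c 0 = c (length (leaves T))"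
      using L R unfolding T edges_proper by simp
  qed
qed

lemma sign_eq_mod_3:
  fixes x y :: 3
  assumes "x \<noteq> 0" "y \<noteq> 0" "(- 1) ^ a * x = (- 1) ^ b * y"
  shows "even (a + b) \<longleftrightarrow> x = y"
  using assms(3) nonzero_mod_3[OF assms(1)] nonzero_mod_3[OF assms(2)]
  by (cases "even a"; cases "even b") auto

text \<open>Both trees use the same colors, so at every leaf pair the two signed constants agree.
  With constants 1 or -1, the leaf signs agree everywhere or nowhere.\<close>

lemma three_colorable_iff:
  assumes "Tp \<noteq> Tip" "Tm \<noteq> Tip" "length (leaves Tp) = length (leaves Tm)"
  shows "three_colorable Tp Tm \<longleftrightarrow> (\<exists>s. \<forall>k < length (leaves Tp).
    even (leaf_parity (leaves Tp ! k) + leaf_parity (leaves Tm ! k)) = s)"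
proof -
  let ?n = "length (leaves Tp)"
  have "three_colorable Tp Tm \<longleftrightarrow> (\<exists>c :: nat \<Rightarrow> 3.
      ((\<forall>p q. edge_separates Tp p q \<longrightarrow> c p \<noteq> c q) \<and> c 0 = c (length (leaves Tp))) \<and>
      ((\<forall>p q. edge_separates Tm p q \<longrightarrow> c p \<noteq> c q) \<and> c 0 = c (length (leaves Tm))))"
    unfolding three_colorable_def assms(3) by (intro arg_cong[where f = Ex] ext) blast
  also have "\<dots> \<longleftrightarrow> (\<exists>c :: nat \<Rightarrow> 3. (\<exists>e. e \<noteq> 0 \<and> (\<forall>k < ?n. c (Suc k) - c k = (- 1) ^ leaf_parity (leaves Tp ! k) * e)) \<and>
      (\<exists>e. e \<noteq> 0 \<and> (\<forall>k < ?n. c (Suc k) - c k = (- 1) ^ leaf_parity (leaves Tm ! k) * e)))"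
    unfolding tree_coloring_iff[OF assms(1)] tree_coloring_iff[OF assms(2)]
    unfolding assms(3) by (rule refl)
  also have "\<dots> \<longleftrightarrow> (\<exists>s. \<forall>k < ?n. even (leaf_parity (leaves Tp ! k) + leaf_parity (leaves Tm ! k)) = s)"
  proof (intro iffI; (elim exE conjE)?)
    fix c :: "nat \<Rightarrow> 3" and e e'
    assume H: "e \<noteq> 0" "\<forall>k < ?n. c (Suc k) - c k = (- 1) ^ leaf_parity (leaves Tp ! k) * e"
      "e' \<noteq> 0" "\<forall>k < ?n. c (Suc k) - c k = (- 1) ^ leaf_parity (leaves Tm ! k) * e'"
    have "even (leaf_parity (leaves Tp ! k) + leaf_parity (leaves Tm ! k)) \<longleftrightarrow> e = e'" if "k < ?n" for k
      using H that by (intro sign_eq_mod_3) metis+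
    then show "\<exists>s. \<forall>k < ?n. even (leaf_parity (leaves Tp ! k) + leaf_parity (leaves Tm ! k)) = s" by blast
  next
    fix s assume s: "\<forall>k < ?n. even (leaf_parity (leaves Tp ! k) + leaf_parity (leaves Tm ! k)) = s"
    \<comment> \<open>Partial sums of the differences that the top tree prescribes for the constant
      1; the bottom tree then has the constant \<open>e'\<close>.\<close>
    define c :: "nat \<Rightarrow> 3" where "c = (\<lambda>i. \<Sum>j<i. (- 1) ^ leaf_parity (leaves Tp ! j))"
    define e' :: 3 where "e' = (if s then 1 else - 1)"
    have "c (Suc k) - c k = (- 1) ^ leaf_parity (leaves Tp ! k) * 1" for k
      by (simp add: c_def)
    moreover have "(- 1) ^ leaf_parity (leaves Tp ! k) = (- 1) ^ leaf_parity (leaves Tm ! k) * e'" if "k < ?n" for k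
      using s[rule_format, OF that] unfolding e'_def
      by (cases "even (leaf_parity (leaves Tp ! k))"; cases "even (leaf_parity (leaves Tm ! k))") auto
    moreover have "e' \<noteq> 0" by (simp add: e'_def)
    ultimately show "\<exists>c :: nat \<Rightarrow> 3. (\<exists>e. e \<noteq> 0 \<and> (\<forall>k < ?n. c (Suc k) - c k = (- 1) ^ leaf_parity (leaves Tp ! k) * e)) \<and>
      (\<exists>e. e \<noteq> 0 \<and> (\<forall>k < ?n. c (Suc k) - c k = (- 1) ^ leaf_parity (leaves Tm ! k) * e))"
      by (intro exI[of _ c] conjI exI[of _ 1] exI[of _ e']) auto
  qed
  finally show ?thesis .
qed

section \<open>Colorability as constancy of the twist\<close>

lemma ex_leaf_containing:
  assumes "x \<in> {0..1}"
  shows "\<exists>k < length (leaves T). \<exists>y\<in>{0..1}. x = word_map (leaves T ! k) y"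
proof -
  define N where "N = Max (length ` set (leaves T))"
  obtain w y where w: "length w = N" "y \<in> {0..1}" "x = word_map w y"
    using ex_word_containing[OF assms] by blast
  have "length u \<le> length w" if "u \<in> set (leaves T)" for u
    unfolding w N_def using that by (intro Max_ge) auto
  then obtain k where k: "k < length (leaves T)" "prefix (leaves T ! k) w"
    using ex_leaf_prefix by blast
  then obtain u where "w = leaves T ! k @ u" by (auto elim: prefixE)
  then have "x = word_map (leaves T ! k) (word_map u y)"
    using w(3) by (simp add: word_map_append)
  then show ?thesis using k(1) word_map_bounds[OF w(2)] by blast
qed

lemma nth_leaves_not_Nil: "T \<noteq> Tip \<Longrightarrow> k < length (leaves T) \<Longrightarrow> leaves T ! k \<noteq> []"
  by (cases T) (auto simp: nth_append)

text \<open>The slope exponent is the difference of the leaf lengths, which mod 2 is their sum, and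
  the first digits of the leaves are the half indicators.\<close>

lemma twist_on_leaf:
  assumes "represents Tp Tm f" "Tp \<noteq> Tip" "Tm \<noteq> Tip" "k < length (leaves Tp)" "y \<in> {0<..<1}"
  shows "twist f (word_map (leaves Tp ! k) y) \<longleftrightarrow>
    even (leaf_parity (leaves Tp ! k) + leaf_parity (leaves Tm ! k))"
proof -
  let ?u = "leaves Tp ! k" and ?v = "leaves Tm ! k"
  have f: "f (word_map ?u y) = word_map ?v y" if "y \<in> {0..1}" for y
    using assms(1,4) that by (simp add: represents_iff)
  have ne: "?u \<noteq> []" "?v \<noteq> []"
    using assms nth_leaves_not_Nil by (auto simp: represents_iff)
  have x: "word_map ?u y \<in> {word_map ?u 0<..<word_map ?u 1}"
    using assms(5) word_map_strict_mono by auto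
  have "has_slope f (word_map ?u y) (int (length ?u) - int (length ?v))"
    by (rule has_slope_word[OF f x])
  then have "twist f (word_map ?u y) \<longleftrightarrow> even (int (length ?u) - int (length ?v)
      + of_bool (1/2 \<le> word_map ?u y) + of_bool (1/2 \<le> f (word_map ?u y)))"
    by (rule twist_iff) (use assms(5) in \<open>intro word_map_bounds, simp\<close>)
  also have "f (word_map ?u y) = word_map ?v y" by (rule f) (use assms(5) in simp)
  finally show ?thesis
    unfolding word_map_half_le[OF ne(1) assms(5)] word_map_half_le[OF ne(2) assms(5)] leaf_parity_def
    by (auto simp: of_bool_def split: if_splits)
qed

lemma eventually_twist_on_leaf:
  assumes "represents Tp Tm f" "Tp \<noteq> Tip" "Tm \<noteq> Tip"
  shows "\<forall>\<^sub>F x in generic. \<exists>k < length (leaves Tp).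
    twist f x = even (leaf_parity (leaves Tp ! k) + leaf_parity (leaves Tm ! k))" (is "eventually ?P _")
proof -
  \<comment> \<open>The exceptional points are among the ends of the leaf intervals.\<close>
  define S where "S = (\<Union>k < length (leaves Tp). {word_map (leaves Tp ! k) 0, word_map (leaves Tp ! k) 1})"
  have "{x \<in> {0<..<1}. \<not> ?P x} \<subseteq> S"
  proof
    fix x assume x: "x \<in> {x \<in> {0<..<1}. \<not> ?P x}"
    then have "x \<in> {0..1}" by simp
    then obtain k y where k: "k < length (leaves Tp)" "y \<in> {0..1}" "x = word_map (leaves Tp ! k) y"
      using ex_leaf_containing by blast
    have "y \<notin> {0<..<1}" using twist_on_leaf[OF assms k(1), of y] x k by blast
    then have "y = 0 \<or> y = 1" using k(2) by auto
    then show "x \<in> S" using k by (auto simp: S_def)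
  qed
  moreover have "finite S" unfolding S_def by auto
  ultimately show ?thesis unfolding eventually_generic by (rule finite_subset)
qed

lemma length_leaves_eq_1: "length (leaves T) = 1 \<longleftrightarrow> T = Tip"
proof (cases T)
  case (Caret l r)
  have "0 < length (leaves l)" "0 < length (leaves r)" using leaves_not_Nil by auto
  then have "length (leaves T) \<noteq> 1" unfolding Caret leaves.simps length_append length_map by linarith
  then show ?thesis using Caret by simp
qed auto

lemma three_colorable_iff_twist_const:
  assumes "f \<in> carrier thompson_F" "represents Tp Tm f"
  shows "three_colorable Tp Tm \<longleftrightarrow> (\<exists>s. \<forall>\<^sub>F x in generic. twist f x = s)"
proof (cases "Tp = Tip")
  case True
  then have Tm: "Tm = Tip"
    using assms(2) length_leaves_eq_1[of Tm] by (simp add: represents_iff)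
  \<comment> \<open>The one-leaf diagram represents the identity, for which both sides are
    true.\<close>
  have "f y = y" if "y \<in> {0..1}" for y
    using assms(2) that unfolding True Tm by (simp add: represents_iff)
  then have "f = \<one>\<^bsub>thompson_F\<^esub>"
    using assms(1) unfolding one_thompson_F carrier_thompson_F by (auto intro!: extensionalityI)
  then have "\<forall>\<^sub>F x in generic. twist f x = True"
    using eventually_generic_unit by (auto elim!: eventually_mono intro: twist_one)
  moreover have "three_colorable Tp Tm"
    unfolding three_colorable_def True Tm edge_separates_def by auto
  ultimately show ?thesis by blast
next
  case False
  have n: "length (leaves Tp) = length (leaves Tm)" using assms(2) by (simp add: represents_iff)
  then have F': "Tm \<noteq> Tip" using False length_leaves_eq_1 by metis
  show ?thesis unfolding three_colorable_iff[OF False F' n]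
  proof (intro iffI; elim exE)
    fix s assume "\<forall>k < length (leaves Tp). even (leaf_parity (leaves Tp ! k) + leaf_parity (leaves Tm ! k)) = s"
    then have "\<forall>\<^sub>F x in generic. twist f x = s"
      using eventually_twist_on_leaf[OF assms(2) False F'] by (auto elim!: eventually_mono)
    then show "\<exists>s. \<forall>\<^sub>F x in generic. twist f x = s" ..
  next
    fix s assume s: "\<forall>\<^sub>F x in generic. twist f x = s"
    have "even (leaf_parity (leaves Tp ! k) + leaf_parity (leaves Tm ! k)) = s" if k: "k < length (leaves Tp)" for k
    proof -
      let ?u = "leaves Tp ! k"
      have "0 \<le> word_map ?u 0" "word_map ?u 0 < word_map ?u 1" "word_map ?u 1 \<le> 1"
        using word_map_bounds[of 0 ?u] word_map_bounds[of 1 ?u] word_map_strict_mono[of ?u 0 1] by auto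
      \<comment> \<open>Every leaf interval contains a point with twist \<open>s\<close>, and there
        \<open>s\<close> can be read off as the parity of that leaf pair.\<close>
      from eventually_generic_ex[OF s this] obtain x where
        x: "x \<in> {word_map ?u 0<..<word_map ?u 1}" "twist f x = s" by blast
      define y where "y = (x - word_map ?u 0) * 2 ^ length ?u"
      have "x = word_map ?u y" using word_map_affine[of ?u y] by (simp add: y_def)
      moreover from this have "y \<in> {0<..<1}" using x(1) word_map_strict_mono by auto
      ultimately show ?thesis using twist_on_leaf[OF assms(2) False F' k] x(2) by metis
    qed
    then show "\<exists>s. \<forall>k < length (leaves Tp). even (leaf_parity (leaves Tp ! k) + leaf_parity (leaves Tm ! k)) = s"
      by blast
  qed
qed

theorem planar_3col_iff:
  "f \<in> planar_3col \<longleftrightarrow> f \<in> carrier thompson_F \<and> (\<exists>s. \<forall>\<^sub>F x in generic. twist f x = s)"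
proof
  assume "f \<in> planar_3col"
  then obtain Tp Tm where "f \<in> carrier thompson_F" "represents Tp Tm f" "three_colorable Tp Tm"
    unfolding planar_3col_def by blast
  then show "f \<in> carrier thompson_F \<and> (\<exists>s. \<forall>\<^sub>F x in generic. twist f x = s)"
    using three_colorable_iff_twist_const[of f Tp Tm] by simp
next
  assume R: "f \<in> carrier thompson_F \<and> (\<exists>s. \<forall>\<^sub>F x in generic. twist f x = s)"
  then obtain Tp Tm where T: "represents Tp Tm f" using carrier_iff_represents by blast
  then have "three_colorable Tp Tm" using R three_colorable_iff_twist_const[of f Tp Tm] by simp
  then show "f \<in> planar_3col" unfolding planar_3col_def using R T by blast
qed

lemma ex_slope_iff:
  assumes "has_slope f x k" "x \<in> {0..1}"
  shows "(\<exists>j. has_slope f x j \<and> P j) \<longleftrightarrow> P k"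
  using assms has_slope_unique by blast

text \<open>A constant twist ties the parities at the two ends together, so the condition at 0 alone
  decides. Hence both subgroups cut out the same part of the 3-colorable group.\<close>

lemma K_subgroup_twist_const:
  assumes "f \<in> carrier thompson_F" "\<forall>\<^sub>F x in generic. twist f x = s"
  shows "f \<in> K_subgroup 2 2 \<longleftrightarrow> s" "f \<in> K_subgroup 2 1 \<longleftrightarrow> s"
proof -
  obtain k e where "0 < e" "\<forall>x\<in>{0..<e}. has_slope f x k" using slope_near_0[OF assms(1)] by blast
  then have k: "has_slope f 0 k" by simp
  obtain l e where "0 < e" "\<forall>x\<in>{1 - e<..1}. has_slope f x l" using slope_near_1[OF assms(1)] by blast
  then have l: "has_slope f 1 l" by simp
  have s: "even k \<longleftrightarrow> s" "even l \<longleftrightarrow> s"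
    using twist_const_slope[OF assms(1,2)] k l by blast+
  have "(\<exists>j. has_slope f 0 j \<and> even j) \<longleftrightarrow> even k" "(\<exists>j. has_slope f 1 j \<and> even j) \<longleftrightarrow> even l"
    using ex_slope_iff[OF k] ex_slope_iff[OF l] by simp_all
  then show "f \<in> K_subgroup 2 2 \<longleftrightarrow> s" "f \<in> K_subgroup 2 1 \<longleftrightarrow> s"
    unfolding K_subgroup_iff using assms(1) s l by auto
qed

theorem planar_3col_even_iff:
  "f \<in> planar_3col_even \<longleftrightarrow> f \<in> carrier thompson_F \<and> (\<forall>\<^sub>F x in generic. twist f x)"
proof
  assume "f \<in> planar_3col_even"
  then obtain s where "f \<in> carrier thompson_F" "\<forall>\<^sub>F x in generic. twist f x = s" "f \<in> K_subgroup 2 2"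
    unfolding planar_3col_even_def Int_iff planar_3col_iff by (elim conjE exE)
  then show "f \<in> carrier thompson_F \<and> (\<forall>\<^sub>F x in generic. twist f x)"
    using K_subgroup_twist_const(1)[of f s] by simp
next
  assume H: "f \<in> carrier thompson_F \<and> (\<forall>\<^sub>F x in generic. twist f x)"
  then have "\<forall>\<^sub>F x in generic. twist f x = True" by simp
  then show "f \<in> planar_3col_even"
    using H K_subgroup_twist_const(1)[of f True] unfolding planar_3col_even_def Int_iff planar_3col_iff
    by (intro conjI exI[of _ True]) simp_all
qed

lemma planar_3col_Int_K_2_1: "planar_3col \<inter> K_subgroup 2 1 = planar_3col_even"
proof (rule Set.set_eqI)
  show "f \<in> planar_3col \<inter> K_subgroup 2 1 \<longleftrightarrow> f \<in> planar_3col_even" for f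
    unfolding planar_3col_even_def Int_iff planar_3col_iff
    by (metis K_subgroup_twist_const)
qed

section \<open>Commensurators of abstract subgroups\<close>

lemma conjugate_set_alt: "conjugate_set G g H = {g \<otimes>\<^bsub>G\<^esub> h \<otimes>\<^bsub>G\<^esub> inv\<^bsub>G\<^esub> g | h. h \<in> H}"
  unfolding conjugate_set_def l_coset_def r_coset_def by auto

context group
begin

text \<open>For a normalizing element the intersection is \<open>H\<close> itself, with a single
  coset.\<close>

lemma commensurator_normalizer:
  assumes "subgroup H G" "g \<in> carrier G" "conjugate_set G g H = H"
  shows "g \<in> commensurator G H"
proof -
  interpret H: subgroup H G by fact
  have "H #>\<^bsub>G\<lparr>carrier := H\<rparr>\<^esub> a = H" if "a \<in> H" for a
    using coset_join2[of a H] that assms(1) H.mem_carrier by (simp add: r_coset_def)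
  then have "rcosets\<^bsub>G\<lparr>carrier := H\<rparr>\<^esub> H \<subseteq> {H}"
    by (auto simp: RCOSETS_def)
  then have "has_finite_index G H H"
    unfolding has_finite_index_def using finite_subset by blast
  then show ?thesis
    using assms(2,3) by (simp add: commensurator_def)
qed

text \<open>Pigeonhole: two of the cosets of \<open>L\<close> given by powers of \<open>k\<close>
  coincide, and cancelling the smaller power leaves a power in \<open>L\<close>.\<close>

lemma finite_index_power:
  assumes "has_finite_index G L H" "\<one> \<in> L" "L \<subseteq> carrier G" "k \<in> carrier G"
    and "\<And>n::nat. k [^] n \<in> H"
  shows "\<exists>m::nat. 0 < m \<and> k [^] m \<in> L"
proof -
  let ?c = "\<lambda>n::nat. L #> (k [^] n)"
  have "range ?c \<subseteq> rcosets\<^bsub>G\<lparr>carrier := H\<rparr>\<^esub> L"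
    using assms(5) by (auto simp: RCOSETS_def r_coset_def)
  then have "finite (range ?c)"
    using assms(1) finite_subset unfolding has_finite_index_def by blast
  then have "\<not> inj ?c" using finite_imageD infinite_UNIV_nat by blast
  then obtain i j where "?c i = ?c j" "i \<noteq> j" by (auto simp: inj_def)
  then obtain i j where ij: "?c i = ?c j" "i < j" by (metis linorder_neqE_nat)
  have "k [^] j \<in> ?c j"
    using assms(2,4) by (auto simp: r_coset_def intro!: bexI[of _ \<one>])
  then obtain l where l: "l \<in> L" "k [^] j = l \<otimes> k [^] i"
    unfolding ij(1)[symmetric] by (auto simp: r_coset_def)
  have "k [^] (j - i) \<otimes> k [^] i = k [^] j"
    using ij(2) assms(4) by (simp add: nat_pow_mult)
  then have "k [^] (j - i) = l"
    using l assms(3,4) by (metis nat_pow_closed right_cancel subsetD)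
  then show ?thesis using l(1) ij(2) by (metis zero_less_diff)
qed

text \<open>Membership of the power in the conjugate of \<open>H\<close> is stated without an
  inverse, so that the cocycle rule applies to both products.\<close>

lemma commensurator_power:
  assumes "subgroup H G" "g \<in> commensurator G H" "k \<in> H"
  shows "\<exists>m::nat. \<exists>h\<in>H. 0 < m \<and> k [^] m \<otimes> g = g \<otimes> h"
proof -
  interpret H: subgroup H G by fact
  have g: "g \<in> carrier G" and fin: "has_finite_index G (H \<inter> conjugate_set G g H) H"
    using assms(2) by (auto simp: commensurator_def)
  have "\<one> = g \<otimes> \<one> \<otimes> inv g" using g by simp
  then have "\<one> \<in> H \<inter> conjugate_set G g H"
    unfolding conjugate_set_alt using H.one_closed by blast
  moreover have "k [^] n \<in> H" for n :: nat
    using subgroup_is_submonoid[OF assms(1)] assms(3) by (induction n) auto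
  ultimately obtain m :: nat where "0 < m" "k [^] m \<in> H \<inter> conjugate_set G g H"
    using finite_index_power[OF fin] H.subset assms(3) by blast
  then obtain h where h: "0 < m" "h \<in> H" "k [^] m = g \<otimes> h \<otimes> inv g"
    unfolding conjugate_set_alt by blast
  then have "k [^] m \<otimes> g = g \<otimes> h"
    using g H.mem_carrier by (simp add: m_assoc)
  then show ?thesis using h by blast
qed

text \<open>Products and inverses of elements of \<open>K\<close> are those of \<open>G\<close>, so
  conjugates by elements of \<open>K\<close> and coset spaces are unchanged.\<close>

lemma commensurator_subgroup:
  assumes "subgroup K G" "H \<subseteq> K"
  shows "commensurator (G\<lparr>carrier := K\<rparr>) H = K \<inter> commensurator G H"
proof -
  have "conjugate_set (G\<lparr>carrier := K\<rparr>) g H = conjugate_set G g H" if "g \<in> K" for g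
    unfolding conjugate_set_alt using m_inv_consistent[OF assms(1) that] by simp
  moreover have "K \<subseteq> carrier G" using assms(1) by (rule subgroup.subset)
  ultimately show ?thesis
    by (auto simp: commensurator_def has_finite_index_def)
qed

end


section \<open>The commensurator of the even subgroup\<close>

text \<open>The cocycle rule for the product of the inverse with \<open>f\<close>, which has trivial
  twist.\<close>

lemma twist_inv:
  assumes "f \<in> carrier thompson_F"
  shows "\<forall>\<^sub>F x in generic. twist (inv\<^bsub>thompson_F\<^esub> f) x \<longleftrightarrow> twist f ((inv\<^bsub>thompson_F\<^esub> f) x)"
  using twist_mult[OF F.inv_closed[OF assms] assms] eventually_generic_unit
proof eventually_elim
  case (elim x)
  then show ?case using twist_one[of x] assms by simp
qed

lemma planar_3col_inv:
  assumes "g \<in> planar_3col"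
  shows "inv\<^bsub>thompson_F\<^esub> g \<in> planar_3col"
proof -
  from assms obtain s where g: "g \<in> carrier thompson_F" and s: "\<forall>\<^sub>F x in generic. twist g x = s"
    unfolding planar_3col_iff by (elim conjE exE)
  have "\<forall>\<^sub>F x in generic. twist (inv\<^bsub>thompson_F\<^esub> g) x = s"
    using twist_inv[OF g] eventually_generic_compose[OF F.inv_closed[OF g] s]
    by eventually_elim simp
  then show ?thesis unfolding planar_3col_iff using g by auto
qed

lemma subgroup_planar_3col_even: "subgroup planar_3col_even thompson_F"
proof (rule F.subgroupI)
  show "planar_3col_even \<subseteq> carrier thompson_F" using planar_3col_even_iff by blast
  have "\<forall>\<^sub>F x in generic. twist \<one>\<^bsub>thompson_F\<^esub> x"
    using eventually_generic_unit by eventually_elim (simp add: twist_one)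
  then have "\<one>\<^bsub>thompson_F\<^esub> \<in> planar_3col_even" by (simp add: planar_3col_even_iff)
  then show "planar_3col_even \<noteq> {}" by blast
  show "inv\<^bsub>thompson_F\<^esub> f \<in> planar_3col_even" if "f \<in> planar_3col_even" for f
  proof -
    have f: "f \<in> carrier thompson_F" "\<forall>\<^sub>F x in generic. twist f x"
      using that by (simp_all add: planar_3col_even_iff)
    have "\<forall>\<^sub>F x in generic. twist (inv\<^bsub>thompson_F\<^esub> f) x"
      using twist_inv[OF f(1)] eventually_generic_compose[OF F.inv_closed[OF f(1)] f(2)]
      by eventually_elim simp
    then show ?thesis using f(1) by (simp add: planar_3col_even_iff)
  qed
  show "f \<otimes>\<^bsub>thompson_F\<^esub> g \<in> planar_3col_even" if "f \<in> planar_3col_even" "g \<in> planar_3col_even" for f g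
  proof -
    have f: "f \<in> carrier thompson_F" "\<forall>\<^sub>F x in generic. twist f x"
      and g: "g \<in> carrier thompson_F" "\<forall>\<^sub>F x in generic. twist g x"
      using that by (simp_all add: planar_3col_even_iff)
    have "\<forall>\<^sub>F x in generic. twist (f \<otimes>\<^bsub>thompson_F\<^esub> g) x"
      using twist_mult[OF f(1) g(1)] f(2) eventually_generic_compose[OF f(1) g(2)]
      by eventually_elim simp
    then show ?thesis using f(1) g(1) by (simp add: planar_3col_even_iff)
  qed
qed

text \<open>The constant twist of \<open>g\<close> enters once through \<open>g\<close> and once
  through its inverse and cancels; \<open>h\<close> contributes nothing.\<close>

lemma conjugate_even_subset:
  assumes "g \<in> planar_3col"
  shows "conjugate_set thompson_F g planar_3col_even \<subseteq> planar_3col_even"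
proof
  fix f assume "f \<in> conjugate_set thompson_F g planar_3col_even"
  then obtain h where h: "h \<in> planar_3col_even" "f = g \<otimes>\<^bsub>thompson_F\<^esub> h \<otimes>\<^bsub>thompson_F\<^esub> inv\<^bsub>thompson_F\<^esub> g"
    unfolding conjugate_set_alt by blast
  from assms obtain s where g: "g \<in> carrier thompson_F" and s: "\<forall>\<^sub>F x in generic. twist g x = s"
    unfolding planar_3col_iff by (elim conjE exE)
  let ?g' = "inv\<^bsub>thompson_F\<^esub> g"
  have g': "?g' \<in> carrier thompson_F" using g by simp
  have s': "\<forall>\<^sub>F x in generic. twist ?g' x = s"
    using twist_inv[OF g] eventually_generic_compose[OF g' s] by eventually_elim simp
  have hc: "h \<in> carrier thompson_F" "\<forall>\<^sub>F x in generic. twist h x"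
    using h(1) by (simp_all add: planar_3col_even_iff)
  have gh: "g \<otimes>\<^bsub>thompson_F\<^esub> h \<in> carrier thompson_F" using g hc by simp
  have "\<forall>\<^sub>F x in generic. twist f x"
    unfolding h(2)
    using twist_mult[OF gh g'] eventually_generic_compose[OF gh s'] twist_mult[OF g hc(1)] s
      eventually_generic_compose[OF g hc(2)]
    by eventually_elim simp
  then show "f \<in> planar_3col_even"
    unfolding h(2) using gh g' by (simp add: planar_3col_even_iff)
qed

lemma conjugate_even:
  assumes "g \<in> planar_3col"
  shows "conjugate_set thompson_F g planar_3col_even = planar_3col_even"
proof (rule equalityI[OF conjugate_even_subset[OF assms] subsetI])
  fix h assume h: "h \<in> planar_3col_even"
  have g: "g \<in> carrier thompson_F" using assms by (simp add: planar_3col_def)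
  have hc: "h \<in> carrier thompson_F" using h by (simp add: planar_3col_even_iff)
  \<comment> \<open>The reverse inclusion is the same inclusion for the inverse of
    \<open>g\<close>.\<close>
  let ?h = "inv\<^bsub>thompson_F\<^esub> g \<otimes>\<^bsub>thompson_F\<^esub> h \<otimes>\<^bsub>thompson_F\<^esub> g"
  have "?h \<in> conjugate_set thompson_F (inv\<^bsub>thompson_F\<^esub> g) planar_3col_even"
    unfolding conjugate_set_alt using h g by auto
  then have "?h \<in> planar_3col_even"
    using conjugate_even_subset[OF planar_3col_inv[OF assms]] by blast
  moreover have "h = g \<otimes>\<^bsub>thompson_F\<^esub> ?h \<otimes>\<^bsub>thompson_F\<^esub> inv\<^bsub>thompson_F\<^esub> g"
  proof -
    have "g \<otimes>\<^bsub>thompson_F\<^esub> ?h \<otimes>\<^bsub>thompson_F\<^esub> inv\<^bsub>thompson_F\<^esub> g =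
        (g \<otimes>\<^bsub>thompson_F\<^esub> inv\<^bsub>thompson_F\<^esub> g) \<otimes>\<^bsub>thompson_F\<^esub> h \<otimes>\<^bsub>thompson_F\<^esub> (g \<otimes>\<^bsub>thompson_F\<^esub> inv\<^bsub>thompson_F\<^esub> g)"
      using g hc by (simp only: F.m_assoc F.m_closed F.inv_closed)
    then show ?thesis using g hc by simp
  qed
  ultimately show "h \<in> conjugate_set thompson_F g planar_3col_even"
    unfolding conjugate_set_alt by blast
qed

text \<open>The square of the generator \<open>x\<^sub>0\<close> of F.\<close>

definition pusher :: "real \<Rightarrow> real" where
  "pusher = (\<lambda>t\<in>{0..1}. if t \<le> 1/8 then 4 * t else if t \<le> 1/4 then 2 * t + 1/4
    else if t \<le> 1/2 then t / 2 + 5/8 else t / 4 + 3/4)"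

lemma pusher_even: "pusher \<in> planar_3col_even"
proof -
  let ?Tp = "Caret (Caret (Caret Tip Tip) Tip) Tip" and ?Tm = "Caret Tip (Caret Tip (Caret Tip Tip))"
  have R: "represents ?Tp ?Tm pusher"
    unfolding represents_iff by (auto simp: pusher_def less_Suc_eq field_simps)
  then have c: "pusher \<in> carrier thompson_F"
    unfolding carrier_iff_represents by (auto simp: pusher_def)
  \<comment> \<open>The leaf parities are 3, 3, 2, 2 above and 1, 3, 4, 4 below.\<close>
  have "even (leaf_parity (leaves ?Tp ! k) + leaf_parity (leaves ?Tm ! k))" if "k < length (leaves ?Tp)" for k
    using that by (auto simp: less_Suc_eq leaf_parity_def)
  then have "\<forall>\<^sub>F x in generic. twist pusher x"
    using eventually_twist_on_leaf[OF R] by (auto elim!: eventually_mono)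
  then show ?thesis using c by (simp add: planar_3col_even_iff)
qed

lemma pusher_increases: "x \<in> {0<..<1} \<Longrightarrow> x < pusher x"
  by (auto simp: pusher_def)

lemma pusher_power_increases:
  assumes "x \<in> {0<..<1}" "0 < m"
  shows "x < (pusher [^]\<^bsub>thompson_F\<^esub> (m::nat)) x"
  using assms(2)
proof (induction m)
  case (Suc m)
  have p: "pusher \<in> carrier thompson_F" using pusher_even by (simp add: planar_3col_even_iff)
  have x: "x \<in> {0..1}" using assms(1) by simp
  let ?y = "(pusher [^]\<^bsub>thompson_F\<^esub> m) x"
  have "?y \<in> {0<..<1}" by (rule thompson_F_bounds_strict[OF F.nat_pow_closed[OF p] assms(1)])
  then have "?y < pusher ?y" by (rule pusher_increases)
  moreover have "x \<le> ?y"
  proof (cases "m = 0")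
    case True
    then show ?thesis using x by (simp add: one_thompson_F)
  qed (use Suc.IH in simp)
  ultimately show ?case by (simp add: mult_thompson_F_apply[OF x])
qed simp

lemma twist_invariant_const:
  assumes g: "g \<in> carrier thompson_F" and p: "p \<in> carrier thompson_F"
    and up: "\<And>x. x \<in> {0<..<1} \<Longrightarrow> x < p x"
    and inv: "\<forall>\<^sub>F x in generic. twist g (p x) = twist g x"
  shows "\<exists>s. \<forall>\<^sub>F x in generic. twist g x = s"
proof -
  obtain k d where d: "0 < d" "d \<le> 1/2" "\<And>x. x \<in> {0..<d} \<Longrightarrow> has_slope g x k \<and> g x < 1/2"
    using slope_near_0[OF g] by blast
  have near0: "twist g x = even k" if "x \<in> {0..<d}" for x
    using twist_iff[of g x k] d(2) d(3)[OF that] that by auto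
  obtain l e where e: "0 < e" "e \<le> 1/2" "\<And>x. x \<in> {1 - e<..1} \<Longrightarrow> has_slope g x l \<and> 1/2 < g x"
    using slope_near_1[OF g] by blast
  have near1: "twist g x = even l" if "x \<in> {1 - e<..1}" for x
    using twist_iff[of g x l] e(2) e(3)[OF that] that by auto
  \<comment> \<open>\<open>A\<close> collects the points beyond which the twist has its value near
    1, up to finitely many exceptions; its infimum turns out to be 0.\<close>
  define A where "A = {a \<in> {0..1}. \<forall>\<^sub>F x in generic. a < x \<longrightarrow> twist g x = even l}"
  have "\<forall>\<^sub>F x in generic. 1 - e < x \<longrightarrow> twist g x = even l"
    using eventually_generic_unit by eventually_elim (simp add: near1)
  then have inA: "1 - e \<in> A" using e by (simp add: A_def)
  have bdd: "bdd_below A" by (auto simp: A_def intro!: bdd_belowI[of _ 0])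
  define t where "t = Inf A"
  have "0 \<le> t" unfolding t_def using inA by (intro cInf_greatest) (blast, simp add: A_def)
  have "t \<le> 1 - e" unfolding t_def using inA bdd by (rule cInf_lower)
  have "t = 0"
  proof (rule ccontr)
    assume "t \<noteq> 0"
    then have t: "t \<in> {0<..<1}" using \<open>0 \<le> t\<close> \<open>t \<le> 1 - e\<close> e by simp
    \<comment> \<open>A positive infimum \<open>t\<close> is pushed up, so some \<open>a\<close> in
      \<open>A\<close> lies below \<open>p t\<close>. By invariance its preimage \<open>b\<close> is
      again in \<open>A\<close>, but \<open>b\<close> lies below \<open>t\<close>.\<close>
    then have "Inf A < p t" using up by (simp add: t_def)
    then obtain a where a: "a \<in> A" "a < p t" using cInf_lessD inA by blast
    then obtain b where b: "b \<in> {0..1}" "p b = a"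
      using thompson_F_bij[OF p] unfolding bij_betw_def A_def by (metis (no_types, lifting) imageE mem_Collect_eq)
    have "b < t"
    proof (rule ccontr)
      assume "\<not> b < t"
      then have "p t \<le> p b"
        using b(1) t by (intro strict_mono_on_leD[OF thompson_F_strict_mono[OF p]]) auto
      then show False using a(2) b(2) by simp
    qed
    have "\<forall>\<^sub>F x in generic. a < x \<longrightarrow> twist g x = even l" using a(1) by (simp add: A_def)
    from inv eventually_generic_compose[OF p this] eventually_generic_unit
    have "\<forall>\<^sub>F x in generic. b < x \<longrightarrow> twist g x = even l"
    proof eventually_elim
      case (elim x)
      show ?case
      proof
        assume "b < x"
        then have "a < p x"
          using strict_mono_onD[OF thompson_F_strict_mono[OF p], of b x] b elim(3) by auto
        then show "twist g x = even l" using elim by simp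
      qed
    qed
    then have "b \<in> A" using b(1) by (simp add: A_def)
    then have "t \<le> b" unfolding t_def using bdd by (intro cInf_lower)
    then show False using \<open>b < t\<close> by simp
  qed
  \<comment> \<open>Infimum 0 alone would allow exceptions to accumulate at 0. The twist is constant
    on [0,d), and this overlaps (a,1), so the two values agree and cover (0,1).\<close>
  then have "Inf A < d" using d(1) by (simp add: t_def)
  then obtain a where a: "a \<in> A" "a < d" using cInf_lessD inA by blast
  have aA: "0 \<le> a" "\<forall>\<^sub>F x in generic. a < x \<longrightarrow> twist g x = even l" using a(1) by (auto simp: A_def)
  obtain x where x: "x \<in> {a<..<d}" "a < x \<longrightarrow> twist g x = even l"
    using eventually_generic_ex[OF aA(2,1) a(2)] d(2) by auto
  then have "even k = even l" using near0[of x] aA(1) by auto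
  from aA(2) eventually_generic_unit have "\<forall>\<^sub>F x in generic. twist g x = even l"
  proof eventually_elim
    case (elim x)
    then show ?case using near0[of x] \<open>even k = even l\<close> a(2) by (cases "a < x") auto
  qed
  then show ?thesis ..
qed

lemma commensurator_planar_3col_even: "commensurator thompson_F planar_3col_even = planar_3col"
proof (rule Set.set_eqI)
  fix g
  show "g \<in> commensurator thompson_F planar_3col_even \<longleftrightarrow> g \<in> planar_3col"
  proof
    assume "g \<in> planar_3col"
    then show "g \<in> commensurator thompson_F planar_3col_even"
      using conjugate_even subgroup_planar_3col_even
      by (intro F.commensurator_normalizer) (auto simp: planar_3col_def)
  next
    assume comm: "g \<in> commensurator thompson_F planar_3col_even"
    then have g: "g \<in> carrier thompson_F" by (simp add: commensurator_def)
    obtain m h where m: "0 < m" "h \<in> planar_3col_even"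
      "pusher [^]\<^bsub>thompson_F\<^esub> (m::nat) \<otimes>\<^bsub>thompson_F\<^esub> g = g \<otimes>\<^bsub>thompson_F\<^esub> h"
      using F.commensurator_power[OF subgroup_planar_3col_even comm pusher_even] by blast
    let ?p = "pusher [^]\<^bsub>thompson_F\<^esub> m"
    have "?p \<in> planar_3col_even"
      using pusher_even subgroup.m_closed[OF subgroup_planar_3col_even] subgroup.one_closed[OF subgroup_planar_3col_even]
      by (induction m) auto
    then have p: "?p \<in> carrier thompson_F" "\<forall>\<^sub>F x in generic. twist ?p x"
      by (simp_all add: planar_3col_even_iff)
    have h: "h \<in> carrier thompson_F" "\<forall>\<^sub>F x in generic. twist h x"
      using m(2) by (simp_all add: planar_3col_even_iff)
    \<comment> \<open>Both factorizations of the product are expanded by the cocycle rule; the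
      twists of the even elements \<open>?p\<close> and \<open>h\<close> drop out.\<close>
    have "\<forall>\<^sub>F x in generic. twist g (?p x) = twist g x"
      using twist_mult[OF p(1) g] p(2) twist_mult[OF g h(1)] eventually_generic_compose[OF g h(2)]
      unfolding m(3) by eventually_elim simp
    then show "g \<in> planar_3col"
      unfolding planar_3col_iff
      using twist_invariant_const[OF g p(1)] pusher_power_increases[OF _ m(1)] g by blast
  qed
qed

theorem theorem3p8:
  shows "commensurator thompson_F planar_3col_even = planar_3col \<and>
    commensurator (thompson_F\<lparr>carrier := K_subgroup 2 2\<rparr>) planar_3col_even = planar_3col_even \<and>
    commensurator (thompson_F\<lparr>carrier := K_subgroup 2 1\<rparr>) planar_3col_even = planar_3col_even"
proof -
  \<comment> \<open>The commensurator inside either subgroup is its intersection with the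
    3-colorable group, which is the even part in both cases.\<close>
  have "planar_3col_even \<subseteq> K_subgroup 2 2" "planar_3col_even \<subseteq> K_subgroup 2 1"
    using planar_3col_Int_K_2_1 by (auto simp: planar_3col_even_def)
  from this[THEN F.commensurator_subgroup[OF subgroup_K_subgroup]] show ?thesis
    using commensurator_planar_3col_even planar_3col_Int_K_2_1
    by (simp add: planar_3col_even_def Int_commute)
qed

end
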